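(* For each integer $k\ge 3$ there is a constant $\gamma_k>0$ such that for all sufficiently large $t$, \[ r_k(4;t) \;\geq\; \gamma_k\,\frac{t^{2k-1}}{(\log t)^{6(k-1)}}, \] i.e. $r_k(4;t)=\Omega\bigl(t^{2k-1}/(\log t)^{6(k-1)}\bigr)$ as $t\to\infty$.
   Context: For $k\ge 2$, $r_k(4;t)$ denotes the minimum $n$ such that every coloring of the edges of the complete graph $K_n$ with $k$ colors contains a monochromatic $K_4$ in one of the first $k-1$ colors or a monochromatic $K_t$ in the last ($k$-th) color. In particular $r_2(4;t)=r(4,t)$. Logarithms are natural. *)

theory Defs
  imports "HOL-Analysis.Analysis"
begin

definition edge_colouring :: "nat \<Rightarrow> nat \<Rightarrow> (nat \<Rightarrow> nat \<Rightarrow> nat) \<Rightarrow> bool" where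
  "edge_colouring n k c \<longleftrightarrow>
     (\<forall>u<n. \<forall>v<n. u \<noteq> v \<longrightarrow> c u v = c v u \<and> c u v < k)"

definition mono_clique :: "nat \<Rightarrow> (nat \<Rightarrow> nat \<Rightarrow> nat) \<Rightarrow> nat \<Rightarrow> nat \<Rightarrow> bool" where
  "mono_clique n c i s \<longleftrightarrow>
     (\<exists>S. S \<subseteq> {..<n} \<and> card S = s \<and> (\<forall>u\<in>S. \<forall>v\<in>S. u \<noteq> v \<longrightarrow> c u v = i))"

definition ramsey_k4t :: "nat \<Rightarrow> nat \<Rightarrow> nat" where
  "ramsey_k4t k t = (LEAST n. \<forall>c. edge_colouring n k c \<longrightarrow>
       ((\<exists>i<k - 1. mono_clique n c i 4) \<or> mono_clique n c (k - 1) t))"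

end

theory Submission
  imports Defs "HOL-Algebra.Algebraic_Closure_Type" "HOL-Library.Z2" "HOL-Library.Ramsey"
begin

text \<open>
  Take the secant lines of the Hermitian unital over the field with \<open>q\<^sup>2\<close> elements, \<open>q = 2 ^ s\<close>, two
  lines being joined if they meet on the unital. The pencils of the unital points are edge-disjoint
  cliques, and since the unital contains no O'Nan configuration every \<open>K\<^sub>4\<close> has a triangle
  inside one pencil. Splitting each pencil by a random bipartition therefore gives a \<open>K\<^sub>4\<close>-free
  graph on about \<open>q\<^sup>4\<close> vertices (Mattheus--Verstraete). With positive probability every vertex set \<open>W\<close>
  with \<open>|W| \<ge> 8 q\<^sup>2\<close> spans a vertex of degree at least \<open>|W| / (96 s q)\<close>, so by the
  Kleitman--Winston algorithm all independent sets lie in at most \<open>2 ^ (960 s\<^sup>3 q)\<close> containers of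
  size at most \<open>9 q\<^sup>2\<close>.

  With \<open>K = k - 1\<close>, map \<open>n\<close> vertices to a random \<open>K\<close>-tuple of vertices of this graph, give a pair
  the first colour \<open>i\<close> in which its images are adjacent, and the last colour if there is none.
  A clique of size \<open>t\<close> in the last colour is mapped into a product of \<open>K\<close> containers, which is avoided by
  a union bound if \<open>t \<ge> 960 s\<^sup>3 q\<close> and \<open>n\<close> is at most a constant times \<open>t q ^ (2 K)\<close>.
\<close>

subsection \<open>Hermitian unitals have no O'Nan configurations\<close>

text \<open>Capital letters play the conjugates but are independent variables, so this is a
  polynomial identity. The left side is the Gram determinant of three isotropic vectors
  \<open>(x, y, 1)\<close> under \<open>h\<close>: the diagonal vanishes, so only the two 3-cycles
  survive. The right side comes from multiplicativity of determinants, its sign being the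
  determinant of the form.\<close>

lemma hermitian_gram_det:
  fixes x1 :: "'a::comm_ring_1"
  assumes "x1 * X1 = y1 + Y1" "x2 * X2 = y2 + Y2" "x3 * X3 = y3 + Y3"
  defines "h \<equiv> \<lambda>x y u v. x * u - y - (v::'a)"
  shows "h x1 y1 X2 Y2 * h x2 y2 X3 Y3 * h x3 y3 X1 Y1
       + h x2 y2 X1 Y1 * h x3 y3 X2 Y2 * h x1 y1 X3 Y3
       = - ((x1 * (y2 - y3) - x2 * (y1 - y3) + x3 * (y1 - y2)) *
            (X1 * (Y2 - Y3) - X2 * (Y1 - Y3) + X3 * (Y1 - Y2)))"
proof -
  have Y: "Y1 = x1 * X1 - y1" "Y2 = x2 * X2 - y2" "Y3 = x3 * X3 - y3"
    using assms by (auto simp: algebra_simps)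
  show ?thesis unfolding h_def Y by (simp add: algebra_simps)
qed

text \<open>Points 1, 2 and \<open>(u, v)\<close> share the line of slope \<open>m\<close>, and the
  line of slope \<open>n\<close> passes through \<open>(u, v)\<close>. So the equation of the latter
  takes at points 1 and 2 the value \<open>m - n\<close> times the displacement from
  \<open>(u, v)\<close>, and only a relation between displacements remains.\<close>

lemma hermitian_skew:
  fixes x1 :: "'a::comm_ring_1"
  assumes "x1 * X1 = y1 + Y1" "x2 * X2 = y2 + Y2" "u * U = v + V"
    and "y1 = m * x1 + b" "y2 = m * x2 + b" "v = m * u + b" "v = n * u + d"
    and "Y1 = M * X1 + B" "Y2 = M * X2 + B" "V = M * U + B" "V = N * U + D"
  shows "(y2 - n * x2 - d) * (Y1 - N * X1 - D) * (x1 * X2 - y1 - Y2)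
       = - ((y1 - n * x1 - d) * (Y2 - N * X2 - D) * (x2 * X1 - y2 - Y1))"
proof -
  define p P r R where "p = x1 - u" and "P = X1 - U" and "r = x2 - u" and "R = X2 - U"
  have d: "d = (m - n) * u + b" "D = (M - N) * U + B"
    using assms by (auto simp: algebra_simps)
  have e: "y2 - n * x2 - d = (m - n) * r" "y1 - n * x1 - d = (m - n) * p"
     "Y2 - N * X2 - D = (M - N) * R" "Y1 - N * X1 - D = (M - N) * P"
    unfolding d assms(4,5,8,9) p_def P_def r_def R_def by (simp_all add: algebra_simps)
  have x: "x1 = u + p" "x2 = u + r" "X1 = U + P" "X2 = U + R"
    by (auto simp: p_def P_def r_def R_def)
  have uU: "u * U = m * u + b + (M * U + B)" using assms by simp
  \<comment> \<open>Subtracting the isotropy of \<open>(u, v)\<close> from that of each point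
    removes the constant terms.\<close>
  have PB: "P * (u - M) = - (p * (U - m)) - p * P"
    using assms(1) uU unfolding assms(4,8) x by (simp add: algebra_simps)
  have RB: "R * (u - M) = - (r * (U - m)) - r * R"
    using assms(2) uU unfolding assms(5,9) x by (simp add: algebra_simps)
  have h12: "x1 * X2 - y1 - Y2 = p * (U - m) + R * (u - M) + p * R"
    using uU unfolding assms(4,9) x by (simp add: algebra_simps)
  have h21: "x2 * X1 - y2 - Y1 = r * (U - m) + P * (u - M) + r * P"
    using uU unfolding assms(5,8) x by (simp add: algebra_simps)
  have "r * P * (p * (U - m) + R * (u - M) + p * R) = - (p * R * (r * (U - m) + P * (u - M) + r * P))"
  proof -
    have "p * P * (R * (u - M)) = p * P * (- (r * (U - m)) - r * R)"
      "r * R * (P * (u - M)) = r * R * (- (p * (U - m)) - p * P)"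
      using PB RB by simp_all
    from arg_cong2[where f = "(+)", OF this] show ?thesis by (simp add: algebra_simps)
  qed
  moreover have "((m - n) * s) * ((M - N) * t) * z = (m - n) * (M - N) * (s * t * z)" for s t z
    by (simp only: mult_ac)
  ultimately show ?thesis unfolding e h12 h21 by (simp only: mult_minus_right)
qed

text \<open>
  Here \<open>bar\<close> is the involution and the unital is \<open>x \<cdot> bar x = y + bar y\<close>.
  Scaling the Gram matrix of the triangle \<open>L1 L2 L3\<close> by the values of the equation of \<open>L4\<close> at its
  vertices makes it skew, so it is singular, being of odd order. But then the triangle is degenerate.
\<close>
lemma hermitian_onan_free:
  fixes m b :: "nat \<Rightarrow> 'a::field" and x y :: "nat \<Rightarrow> nat \<Rightarrow> 'a" and bar :: "'a \<Rightarrow> 'a"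
  assumes bar: "\<And>u v. bar (u + v) = bar u + bar v" "\<And>u v. bar (u * v) = bar u * bar v"
      "\<And>u. bar u = 0 \<Longrightarrow> u = 0"
    and herm: "\<And>i j. i < j \<Longrightarrow> j \<le> 4 \<Longrightarrow> 1 \<le> i \<Longrightarrow> x i j * bar (x i j) = y i j + bar (y i j)"
    and inc: "\<And>i j. i < j \<Longrightarrow> j \<le> 4 \<Longrightarrow> 1 \<le> i \<Longrightarrow> y i j = m i * x i j + b i \<and> y i j = m j * x i j + b j"
    and tri: "x 1 3 \<noteq> x 2 3" "y 1 2 \<noteq> m 3 * x 1 2 + b 3"
      "y 2 3 \<noteq> m 4 * x 2 3 + b 4" "y 1 3 \<noteq> m 4 * x 1 3 + b 4" "y 1 2 \<noteq> m 4 * x 1 2 + b 4"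
  shows False
proof -
  have bar0: "bar 0 = 0" by (metis add_cancel_right_right bar(1))
  have barm: "bar (- u) = - bar u" for u
  proof -
    have "bar u + bar (- u) = 0" using bar(1)[of u "- u"] bar0 by simp
    then show ?thesis by (rule minus_unique[symmetric])
  qed
  have bard: "bar (u - v) = bar u - bar v" for u v
    using bar(1)[of u "- v"] barm by simp
  \<comment> \<open>The indices \<open>i j\<close> name the meeting point of lines \<open>i\<close>
    and \<open>j\<close>; \<open>?d\<close> is the value there of the equation of the fourth line,
    and \<open>?D\<close> its conjugate.\<close>
  let ?d = "\<lambda>i j. y i j - m 4 * x i j - b 4"
  let ?D = "\<lambda>i j. bar (y i j) - bar (m 4) * bar (x i j) - bar (b 4)"
  let ?h = "\<lambda>i j k l. x i j * bar (x k l) - y i j - bar (y k l)"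
  have incb: "bar (y i j) = bar (m i) * bar (x i j) + bar (b i)"
     "bar (y i j) = bar (m j) * bar (x i j) + bar (b j)" if "i < j" "j \<le> 4" "1 \<le> i" for i j
    using inc[OF that] bar by metis+
  \<comment> \<open>On side \<open>i\<close> of the triangle lie two vertices and the meeting point
    with the fourth line; each side relates the two Gram entries of its pair of vertices.\<close>
  have s3: "?d 1 3 * ?D 2 3 * ?h 2 3 1 3 = - (?d 2 3 * ?D 1 3 * ?h 1 3 2 3)"
    by (rule hermitian_skew[where u = "x 3 4" and v = "y 3 4" and m = "m 3" and b = "b 3" and M = "bar (m 3)"
          and B = "bar (b 3)" and U = "bar (x 3 4)" and V = "bar (y 3 4)"];
        (rule herm inc[THEN conjunct1] inc[THEN conjunct2] incb; simp))
  have s1: "?d 1 2 * ?D 1 3 * ?h 1 3 1 2 = - (?d 1 3 * ?D 1 2 * ?h 1 2 1 3)"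
    by (rule hermitian_skew[where u = "x 1 4" and v = "y 1 4" and m = "m 1" and b = "b 1" and M = "bar (m 1)"
          and B = "bar (b 1)" and U = "bar (x 1 4)" and V = "bar (y 1 4)"];
        (rule herm inc[THEN conjunct1] inc[THEN conjunct2] incb; simp))
  have s2: "?d 2 3 * ?D 1 2 * ?h 1 2 2 3 = - (?d 1 2 * ?D 2 3 * ?h 2 3 1 2)"
    by (rule hermitian_skew[where u = "x 2 4" and v = "y 2 4" and m = "m 2" and b = "b 2" and M = "bar (m 2)"
          and B = "bar (b 2)" and U = "bar (x 2 4)" and V = "bar (y 2 4)"];
        (rule herm inc[THEN conjunct1] inc[THEN conjunct2] incb; simp))
  let ?abc = "?h 2 3 1 3 * ?h 1 3 1 2 * ?h 1 2 2 3"
  let ?cba = "?h 1 3 2 3 * ?h 1 2 1 3 * ?h 2 3 1 2"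
  let ?N = "?d 1 3 * ?D 2 3 * (?d 1 2 * ?D 1 3) * (?d 2 3 * ?D 1 2)"
  \<comment> \<open>Three relations contribute an odd number of signs, so the two 3-cycles cancel
    without a division by two. This is what admits characteristic two.\<close>
  have "?N * ?abc
      = (?d 1 3 * ?D 2 3 * ?h 2 3 1 3) * (?d 1 2 * ?D 1 3 * ?h 1 3 1 2) * (?d 2 3 * ?D 1 2 * ?h 1 2 2 3)"
    by (simp only: mult_ac)
  also have "\<dots> = - (?N * ?cba)"
    unfolding s1 s2 s3 by (simp only: mult_ac mult_minus_left mult_minus_right minus_minus)
  finally have "?N * (?abc + ?cba) = 0"
    by (simp only: distrib_left) simp
  moreover have "?d 1 3 \<noteq> 0" "?d 2 3 \<noteq> 0" "?d 1 2 \<noteq> 0"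
    using tri by (auto simp: algebra_simps)
  moreover have "?D i j = bar (?d i j)" for i j by (simp add: bar bard)
  ultimately have "?abc + ?cba = 0"
    using bar(3) by (metis mult_eq_0_iff)
  moreover have "?abc + ?cba = - ((x 2 3 * (y 1 3 - y 1 2) - x 1 3 * (y 2 3 - y 1 2) + x 1 2 * (y 2 3 - y 1 3))
    * (bar (x 2 3) * (bar (y 1 3) - bar (y 1 2)) - bar (x 1 3) * (bar (y 2 3) - bar (y 1 2))
       + bar (x 1 2) * (bar (y 2 3) - bar (y 1 3))))"
    by (rule hermitian_gram_det; (rule herm; simp))
  moreover define D where "D = x 2 3 * (y 1 3 - y 1 2) - x 1 3 * (y 2 3 - y 1 2) + x 1 2 * (y 2 3 - y 1 3)"
  moreover have "bar (x 2 3) * (bar (y 1 3) - bar (y 1 2)) - bar (x 1 3) * (bar (y 2 3) - bar (y 1 2))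
       + bar (x 1 2) * (bar (y 2 3) - bar (y 1 3)) = bar D"
    unfolding D_def by (simp add: bar bard)
  ultimately have "D = 0" using bar(3) by auto
  \<comment> \<open>The determinant of the three vertices factors because 13 and 23 both lie on side
    3.\<close>
  moreover have "D = (x 1 3 - x 2 3) * (y 1 2 - m 3 * x 1 2 - b 3)"
  proof -
    have "y 1 3 = m 3 * x 1 3 + b 3" "y 2 3 = m 3 * x 2 3 + b 3"
      by (rule inc[THEN conjunct2]; simp)+
    then show ?thesis unfolding D_def by (simp only: algebra_simps)
  qed
  ultimately have "y 1 2 - m 3 * x 1 2 - b 3 = 0" using tri(1) by simp
  then show False using tri(2) by (simp add: diff_diff_eq)
qed

subsection \<open>Frobenius, norm and trace in characteristic two\<close>

text \<open>A multiple root would also be a root of the derivative, so the root multiset of the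
  complete linear factorisation is a set.\<close>

lemma card_poly_roots_separable:
  fixes p :: "'a::alg_closed_field poly"
  assumes p0: "p \<noteq> 0" and sep: "\<And>a. poly p a = 0 \<Longrightarrow> poly (pderiv p) a \<noteq> 0"
  shows "card {x. poly p x = 0} = Polynomial.degree p"
proof -
  obtain A where A: "size A = Polynomial.degree p"
      "p = Polynomial.smult (Polynomial.lead_coeff p) (\<Prod>x\<in>#A. [:-x, 1:])"
    using alg_closed_imp_factorization[OF p0] by blast
  have nz: "(\<Prod>x\<in>#B. [:-x, 1:]) \<noteq> 0" for B :: "'a multiset"
    by (auto simp: prod_mset_zero_iff)
  have "proots (\<Prod>x\<in>#A. [:-x, 1:]) = A"
  proof (induction A)
    case (add x A)
    have "proots ([:- x, 1:] * (\<Prod>x\<in>#A. [:- x, 1:])) = {#x#} + A"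
      using add nz[of A] by (subst proots_mult) auto
    then show ?case by simp
  qed simp
  then have pA: "proots p = A"
    using p0 by (subst A(2)) simp
  have "Polynomial.order a p \<le> 1" for a
  proof (rule ccontr)
    assume "\<not> Polynomial.order a p \<le> 1"
    then have "[:- a, 1:] ^ 2 dvd p"
      using p0 by (subst order_divides) auto
    then obtain r where r: "p = [:- a, 1:] ^ 2 * r" by (elim dvdE)
    have "poly p a = 0" "poly (pderiv p) a = 0"
      unfolding r by (simp_all add: pderiv_mult power2_eq_square del: mult_pCons_left mult_pCons_right)
    with sep show False by blast
  qed
  then have le: "count A a \<le> 1" for a
    using pA p0 by (metis count_proots)
  have "set_mset A = {x. poly p x = 0}"
    using pA set_count_proots[OF p0] by simp
  moreover have "card (set_mset A) = size A"
  proof -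
    have "count A x = 1" if "x \<in># A" for x
      using le[of x] that by (simp add: order_antisym Suc_leI)
    then show ?thesis by (simp add: size_multiset_overloaded_eq)
  qed
  ultimately show ?thesis using A(1) by simp
qed

lemma CHAR_bit: "CHAR(bit) = 2"
proof (rule CHAR_eqI)
  fix n assume "of_nat n = (0 :: bit)"
  then show "2 dvd n" by (metis dvd_0_right even_of_nat)
qed simp

locale binary_frobenius =
  fixes q s :: nat and ty :: "'a::alg_closed_field itself"
  assumes char: "CHAR('a) = 2" and q: "q = 2 ^ s" and s: "s > 0"
begin

text \<open>The field with \<open>q ^ 2\<close> elements, cut out of an algebraically closed field
  so that fibre sizes become root counts. On it \<open>x ^ q\<close> is the conjugation,
  \<open>x * x ^ q\<close> the norm and \<open>y + y ^ q\<close> the trace.\<close>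

definition K :: "'a set" where "K = {x. x ^ q ^ 2 = x}"

lemma q_ge_2: "q \<ge> 2"
  using q s by (cases s) auto

lemma of_nat_q [simp]: "of_nat q = (0::'a)"
  unfolding of_nat_eq_0_iff_char_dvd char q using s by simp

lemma add_self [simp]: "x + x = (0::'a)"
proof -
  have "of_nat 2 = (0::'a)" unfolding of_nat_eq_0_iff_char_dvd char by simp
  then have "(2::'a) = 0" by (simp only: of_nat_numeral)
  then show ?thesis using mult_2[of x] by simp
qed

lemma minus_eq [simp]: "- x = (x::'a)"
  using add_self[of x] by (simp add: eq_neg_iff_add_eq_0 neg_eq_iff_add_eq_0)

lemma frob_add: "(x + y) ^ q = x ^ q + (y::'a) ^ q"
  using char q by (intro freshmans_dream') auto

lemma frob_add2: "(x + y) ^ q ^ 2 = x ^ q ^ 2 + (y::'a) ^ q ^ 2"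
  by (simp add: power2_eq_square power_mult frob_add)

lemma frob_twice: "(x ^ q) ^ q = x ^ q ^ 2" for x :: 'a
  by (simp add: power2_eq_square power_mult)

lemma K_frob: "x \<in> K \<Longrightarrow> (x ^ q) ^ q = x" by (simp add: frob_twice K_def)

lemma K_closed: "x \<in> K \<Longrightarrow> y \<in> K \<Longrightarrow> x + y \<in> K" "x \<in> K \<Longrightarrow> y \<in> K \<Longrightarrow> x * y \<in> K"
    "x \<in> K \<Longrightarrow> x ^ n \<in> K"
  by (auto simp: K_def frob_add2 power_mult_distrib power_commutes) (metis mult.commute power_mult)

text \<open>As \<open>n\<close> vanishes in the field, the derivative is the nonzero constant
  \<open>b\<close>, so all roots are simple. With \<open>b = 1\<close> this counts both
  \<open>K\<close> and the trace fibres.\<close>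

lemma poly_binomial_card:
  assumes "n \<ge> 2" "of_nat n = (0::'a)" "b \<noteq> 0"
  shows "card {x::'a. x ^ n + b * x + c = 0} = n"
proof -
  define p :: "'a poly" where "p = Polynomial.monom 1 n + [:c, b:]"
  have deg: "Polynomial.degree p = n"
    unfolding p_def using assms(1) by (subst degree_add_eq_left) (auto simp: degree_monom_eq intro: le_less_trans[OF degree_pCons_le])
  have "card {x. poly p x = 0} = Polynomial.degree p"
  proof (rule card_poly_roots_separable)
    show "p \<noteq> 0" using deg assms(1) by auto
    show "poly (pderiv p) a \<noteq> 0" for a
      unfolding p_def using assms by (simp add: pderiv_add pderiv_monom pderiv_pCons poly_monom)
  qed
  moreover have "poly p x = x ^ n + b * x + c" for x
    by (simp add: p_def poly_monom algebra_simps)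
  ultimately show ?thesis using deg by simp
qed

lemma card_K: "card K = q ^ 2"
proof -
  have "K = {x. x ^ q ^ 2 + 1 * x + 0 = 0}"
    unfolding K_def by (auto simp: add_eq_0_iff2)
  also have "card \<dots> = q ^ 2"
    using q_ge_2 by (intro poly_binomial_card) (auto simp: power2_eq_square intro: order_trans[OF _ mult_le_mono[of 2 q 1 q]])
  finally show ?thesis .
qed

lemma finite_K: "finite K"
  using card_K q_ge_2 by (intro card_ge_0_finite) simp

lemma card_trace_fibre: "card {y::'a. y + y ^ q = c} = q"
proof -
  have "{y. y + y ^ q = c} = {y. y ^ q + 1 * y + c = 0}"
    by (auto simp: add_eq_0_iff2 add.commute)
  then show ?thesis using poly_binomial_card[of q 1 c] q_ge_2 by simp
qed

lemma finite_trace_fibre: "finite {y::'a. y + y ^ q = c}"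
  using card_trace_fibre[of c] q_ge_2 by (intro card_ge_0_finite) simp

text \<open>The derivative of \<open>x ^ (q + 1) + c\<close> is \<open>x ^ q\<close>, which vanishes
  only at 0, and 0 is no root. Every root lies in \<open>K\<close> because \<open>c\<close> is fixed
  by the Frobenius power.\<close>

lemma card_norm_fibre:
  fixes c :: 'a
  assumes "c \<noteq> 0" "c ^ q = c"
  shows "card {x\<in>K. x * x ^ q = c} = q + 1"
proof -
  define p :: "'a poly" where "p = Polynomial.monom 1 (q + 1) + [:c:]"
  have deg: "Polynomial.degree p = q + 1"
    unfolding p_def by (subst degree_add_eq_left) (auto simp: degree_monom_eq)
  have p: "poly p x = x * x ^ q + c" for x
    by (simp add: p_def poly_monom)
  have "card {x. poly p x = 0} = Polynomial.degree p"
  proof (rule card_poly_roots_separable)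
    show "p \<noteq> 0" using deg by auto
    show "poly (pderiv p) a \<noteq> 0" if "poly p a = 0" for a
    proof -
      have "a \<noteq> 0" using that assms p q_ge_2 by auto
      then show ?thesis
        unfolding p_def by (simp add: pderiv_add pderiv_monom pderiv_pCons poly_monom)
    qed
  qed
  moreover have "{x. poly p x = 0} = {x\<in>K. x * x ^ q = c}"
  proof -
    have "x \<in> K" if x: "x * x ^ q = c" for x
    proof -
      have "x \<noteq> 0" using x assms q_ge_2 by auto
      have "(x * x ^ q) ^ q = x * x ^ q" using x assms by simp
      then have "x ^ q * (x ^ q) ^ q = x ^ q * x" by (simp add: power_mult_distrib mult.commute)
      with \<open>x \<noteq> 0\<close> show ?thesis by (simp add: K_def frob_twice)
    qed
    then show ?thesis by (auto simp: p add_eq_0_iff2)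
  qed
  ultimately show ?thesis using deg by simp
qed

end

subsection \<open>The unital\<close>

text \<open>
  Losing constant factors is harmless, so the line at infinity and its point are left out; this is why
  the number of blocks is only bounded within a factor of two.
\<close>

locale dense_unital =
  fixes q :: nat and P :: "'p set" and \<L> :: "'p set set"
  assumes q_ge_2: "q \<ge> 2"
    and finite_P: "finite P" and card_P: "card P \<le> q ^ 3"
    and block_subset: "L \<in> \<L> \<Longrightarrow> L \<subseteq> P"
    and card_block: "L \<in> \<L> \<Longrightarrow> card L = q + 1"
    and meet_once: "L \<in> \<L> \<Longrightarrow> L' \<in> \<L> \<Longrightarrow> a \<in> L \<inter> L' \<Longrightarrow> b \<in> L \<inter> L' \<Longrightarrow> a \<noteq> b \<Longrightarrow> L = L'"
    and onan_free: "(\<And>i. 1 \<le> i \<Longrightarrow> i \<le> 4 \<Longrightarrow> B i \<in> \<L>) \<Longrightarrow>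
      (\<And>i j. 1 \<le> i \<Longrightarrow> i < j \<Longrightarrow> j \<le> 4 \<Longrightarrow> p i j \<in> B i \<inter> B j) \<Longrightarrow>
      inj_on B {1..4::nat} \<Longrightarrow>
      \<not> distinct [p 1 2, p 1 3, p 1 4, p 2 3, p 2 4, p 3 4]"
    and card_blocks: "q ^ 4 \<le> 2 * card \<L>" "card \<L> \<le> q ^ 4"

section \<open>Affine secant lines of the Hermitian curve\<close>

context binary_frobenius begin

definition unital_points :: "('a \<times> 'a) set" where
  "unital_points = {(x, y). x \<in> K \<and> y \<in> K \<and> x * x ^ q = y + y ^ q}"

definition secant :: "'a \<times> 'a \<Rightarrow> ('a \<times> 'a) set" where
  "secant l = {(x, y) \<in> unital_points. y = fst l * x + snd l}"

text \<open>The inequality excludes tangents: the shift \<open>x = u + m ^ q\<close> turns incidence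
  with the curve into \<open>u * u ^ q = m * m ^ q + (b + b ^ q)\<close>, which has
  \<open>q + 1\<close> solutions in \<open>K\<close> when the right side is nonzero. Vertical lines,
  which pass through the omitted point at infinity, have no coefficients here.\<close>

definition secant_coeffs :: "('a \<times> 'a) set" where
  "secant_coeffs = {(m, b). m \<in> K \<and> b \<in> K \<and> b + b ^ q \<noteq> m * m ^ q}"

lemma card_secant:
  assumes "l \<in> secant_coeffs"
  shows "card (secant l) = q + 1"
proof -
  obtain m b where l: "l = (m, b)" "m \<in> K" "b \<in> K" "b + b ^ q \<noteq> m * m ^ q"
    using assms by (auto simp: secant_coeffs_def)
  define c where "c = m * m ^ q + (b + b ^ q)"
  have "c \<noteq> 0" using l(4) by (auto simp: c_def add_eq_0_iff2)
  moreover have "c ^ q = c"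
    using l(2,3) by (simp add: c_def frob_add power_mult_distrib K_frob add_ac mult.commute)
  ultimately have "card {u\<in>K. u * u ^ q = c} = q + 1" by (rule card_norm_fibre)
  moreover have "bij_betw (\<lambda>u. (u + m ^ q, m * (u + m ^ q) + b)) {u\<in>K. u * u ^ q = c} (secant l)"
  proof -
    have iff: "u * u ^ q = c \<longleftrightarrow>
        (u + m ^ q) * (u + m ^ q) ^ q = m * (u + m ^ q) + b + (m * (u + m ^ q) + b) ^ q" for u
    proof -
      \<comment> \<open>The mixed terms produced by the shift occur in pairs and cancel in
        characteristic two.\<close>
      have "(u + m ^ q) * (u + m ^ q) ^ q + (m * (u + m ^ q) + b + (m * (u + m ^ q) + b) ^ q)
         = u * u ^ q + (b + b ^ q) + m * m ^ q
           + ((m * u + m * u) + (m * m ^ q + m * m ^ q) + (m ^ q * u ^ q + m ^ q * u ^ q))"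
        using l(2) by (simp only: frob_add power_mult_distrib K_frob) (simp only: algebra_simps)
      also have "\<dots> = u * u ^ q + c" by (simp only: add_self) (simp add: c_def add_ac)
      finally show ?thesis
        by (metis add_self add_eq_0_iff2 minus_eq)
    qed
    have K': "u \<in> K \<Longrightarrow> u + m ^ q \<in> K" "u \<in> K \<Longrightarrow> m * (u + m ^ q) + b \<in> K" for u
      using l by (auto intro!: K_closed)
    have "secant l \<subseteq> (\<lambda>u. (u + m ^ q, m * (u + m ^ q) + b)) ` {u\<in>K. u * u ^ q = c}"
    proof
      fix z assume "z \<in> secant l"
      then obtain x where x: "z = (x, m * x + b)" "x \<in> K" "x * x ^ q = (m * x + b) + (m * x + b) ^ q"
        by (auto simp: secant_def unital_points_def l(1))
      have e: "x + m ^ q + m ^ q = x" by (simp add: add.assoc)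
      have "x + m ^ q \<in> K" using x l by (auto intro!: K_closed)
      moreover have "(x + m ^ q) * (x + m ^ q) ^ q = c"
        unfolding iff e using x by simp
      ultimately show "z \<in> (\<lambda>u. (u + m ^ q, m * (u + m ^ q) + b)) ` {u\<in>K. u * u ^ q = c}"
        using x e by (intro image_eqI[where x = "x + m ^ q"]) auto
    qed
    moreover have "(\<lambda>u. (u + m ^ q, m * (u + m ^ q) + b)) ` {u\<in>K. u * u ^ q = c} \<subseteq> secant l"
      using K' iff by (auto simp: secant_def unital_points_def l(1))
    ultimately show ?thesis
      by (intro bij_betw_imageI) (auto simp: inj_on_def)
  qed
  ultimately show ?thesis using bij_betw_same_card by fastforce
qed

lemma secant_meet:
  assumes "a \<in> secant l \<inter> secant l'" "b \<in> secant l \<inter> secant l'" "a \<noteq> b"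
  shows "l = l'"
proof -
  obtain x y x' y' where ab: "a = (x, y)" "b = (x', y')" by (metis surj_pair)
  have e: "fst l * x + snd l = fst l' * x + snd l'" "fst l * x' + snd l = fst l' * x' + snd l'"
    and ne: "x \<noteq> x'"
    using assms unfolding secant_def ab by auto
  have "(fst l - fst l') * (x - x') = 0"
    using arg_cong2[where f = "(-)", OF e] by (simp only: algebra_simps) simp
  then have "fst l = fst l'" using ne by (metis eq_iff_diff_eq_0 mult_eq_0_iff)
  with e show ?thesis by (auto intro: prod_eqI)
qed

lemma inj_secant: "inj_on secant secant_coeffs"
proof
  fix l l' assume l: "l \<in> secant_coeffs" "l' \<in> secant_coeffs" and eq: "secant l = secant l'"
  have "2 \<le> card (secant l)" using card_secant[OF l(1)] q_ge_2 by simp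
  then obtain T where "T \<subseteq> secant l" "card T = 2"
    by (rule obtain_subset_with_card_n)
  then obtain a b where "a \<in> secant l" "b \<in> secant l" "a \<noteq> b"
    by (auto simp: card_2_iff)
  with eq show "l = l'" by (intro secant_meet[of a l l' b]) auto
qed

text \<open>Here \<open>y\<close> need not lie in \<open>K\<close>: the fibres only give upper
  bounds, for the points of the unital and for the excluded tangents.\<close>

lemma card_fibres: "card (SIGMA x:K. {y::'a. y + y ^ q = f x}) = q ^ 3"
  by (subst card_SigmaI) (auto simp: finite_K finite_trace_fibre card_trace_fibre card_K power2_eq_square power3_eq_cube)

lemma card_unital_points: "finite unital_points" "card unital_points \<le> q ^ 3"
proof -
  have sub: "unital_points \<subseteq> (SIGMA x:K. {y. y + y ^ q = x * x ^ q})" by (auto simp: unital_points_def)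
  have fin: "finite (SIGMA x:K. {y. y + y ^ q = x * x ^ q})"
    by (auto simp: finite_K finite_trace_fibre)
  show "finite unital_points" using sub fin by (rule finite_subset)
  show "card unital_points \<le> q ^ 3" using card_mono[OF fin sub] card_fibres[of "\<lambda>x. x * x ^ q"] by simp
qed

lemma card_secant_coeffs: "q ^ 4 \<le> 2 * card secant_coeffs" "card secant_coeffs \<le> q ^ 4"
proof -
  have K2: "card (K \<times> K) = q ^ 4" by (simp add: card_cartesian_product card_K flip: power_add)
  have "secant_coeffs \<subseteq> K \<times> K" by (auto simp: secant_coeffs_def)
  then show "card secant_coeffs \<le> q ^ 4" using K2 card_mono[of "K \<times> K" secant_coeffs] finite_K by simp
  have "K \<times> K \<subseteq> secant_coeffs \<union> (SIGMA m:K. {b. b + b ^ q = m * m ^ q})" by (auto simp: secant_coeffs_def)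
  moreover have "finite (secant_coeffs \<union> (SIGMA m:K. {b. b + b ^ q = m * m ^ q}))"
    using \<open>secant_coeffs \<subseteq> K \<times> K\<close> finite_K finite_trace_fibre by (auto intro: finite_subset)
  ultimately have "q ^ 4 \<le> card (secant_coeffs \<union> (SIGMA m:K. {b. b + b ^ q = m * m ^ q}))"
    using card_mono K2 by metis
  also have "\<dots> \<le> card secant_coeffs + q ^ 3" 
    using card_Un_le[of secant_coeffs "SIGMA m:K. {b. b + b ^ q = m * m ^ q}"] card_fibres[of "\<lambda>m. m * m ^ q"]
    by simp
  finally have "q ^ 4 \<le> card secant_coeffs + q ^ 3" .
  moreover have "2 * q ^ 3 \<le> q ^ 4" using q_ge_2 by (simp add: power4_eq_xxxx power3_eq_cube mult.assoc)
  ultimately show "q ^ 4 \<le> 2 * card secant_coeffs" by simp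
qed

theorem dense_unital: "dense_unital q unital_points (secant ` secant_coeffs)"
proof
  fix B and p :: "nat \<Rightarrow> nat \<Rightarrow> 'a \<times> 'a"
  assume B: "\<And>i. 1 \<le> i \<Longrightarrow> i \<le> 4 \<Longrightarrow> B i \<in> secant ` secant_coeffs"
    and p: "\<And>i j. 1 \<le> i \<Longrightarrow> i < j \<Longrightarrow> j \<le> 4 \<Longrightarrow> p i j \<in> B i \<inter> B j"
    and inj: "inj_on B {1..4}"
  define l where "l i = inv_into secant_coeffs secant (B i)" for i
  have l: "B i = secant (l i)" if "1 \<le> i" "i \<le> 4" for i
    unfolding l_def by (rule f_inv_into_f[OF B[OF that], symmetric])
  have pl: "p i j \<in> secant (l i)" "p i j \<in> secant (l j)" if "i < j" "j \<le> 4" "1 \<le> i" for i j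
    using p[of i j] l[of i] l[of j] that by auto
  show "\<not> distinct [p 1 2, p 1 3, p 1 4, p 2 3, p 2 4, p 3 4]"
  proof
    assume dist: "distinct [p 1 2, p 1 3, p 1 4, p 2 3, p 2 4, p 3 4]"
    have neq: "l i \<noteq> l j" if "i < j" "j \<le> 4" "1 \<le> i" for i j
      using inj_onD[OF inj, of i j] l[of i] l[of j] that by auto
    \<comment> \<open>A line \<open>k\<close> meeting line \<open>i\<close> in \<open>a\<close>
      contains no other point of line \<open>i\<close>. This turns the distinctness of the six
      points into the non-incidences demanded by \<open>hermitian_onan_free\<close>.\<close>
    have ne: "p i j \<notin> secant (l k)"
      if "a \<in> secant (l i)" "a \<in> secant (l k)" "p i j \<noteq> a" "p i j \<in> secant (l i)" "l i \<noteq> l k" for i j k a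
      using secant_meet[of a "l i" "l k" "p i j"] that by auto
    have unital_points: "p i j \<in> unital_points" if "i < j" "j \<le> 4" "1 \<le> i" for i j
      using pl(1)[OF that] by (auto simp: secant_def)
    show False
    proof (rule hermitian_onan_free[where bar = "\<lambda>x. x ^ q" and m = "\<lambda>i. fst (l i)" and b = "\<lambda>i. snd (l i)"
          and x = "\<lambda>i j. fst (p i j)" and y = "\<lambda>i j. snd (p i j)"])
      show "u = 0" if "u ^ q = 0" for u :: 'a using that by simp
      show "fst (p i j) * fst (p i j) ^ q = snd (p i j) + snd (p i j) ^ q"
        if "i < j" "j \<le> 4" "1 \<le> i" for i j
        using unital_points[OF that] by (auto simp: unital_points_def)
      show "snd (p i j) = fst (l i) * fst (p i j) + snd (l i) \<and> snd (p i j) = fst (l j) * fst (p i j) + snd (l j)"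
        if "i < j" "j \<le> 4" "1 \<le> i" for i j
        using pl[OF that] by (auto simp: secant_def)
      have "p 1 3 \<in> secant (l 3)" "p 2 3 \<in> secant (l 3)" by (rule pl; simp)+
      then have "snd (p 1 3) = fst (l 3) * fst (p 1 3) + snd (l 3)"
        "snd (p 2 3) = fst (l 3) * fst (p 2 3) + snd (l 3)" by (auto simp: secant_def)
      moreover have "p 1 3 \<noteq> p 2 3" using dist by auto
      ultimately show "fst (p 1 3) \<noteq> fst (p 2 3)" by (metis prod_eqI)
      have *: "snd (p i j) \<noteq> fst (l k) * fst (p i j) + snd (l k)"
        if "i < j" "j \<le> 4" "1 \<le> i" "p i j \<notin> secant (l k)" for i j k
        using unital_points[OF that(1-3)] that(4) by (auto simp: secant_def)
      show "snd (p 1 2) \<noteq> fst (l 3) * fst (p 1 2) + snd (l 3)"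
        by (rule *[OF _ _ _ ne[of "p 1 3"]]; (rule pl neq)?) (use dist in auto)
      show "snd (p 2 3) \<noteq> fst (l 4) * fst (p 2 3) + snd (l 4)"
        by (rule *[OF _ _ _ ne[of "p 2 4"]]; (rule pl neq)?) (use dist in auto)
      show "snd (p 1 3) \<noteq> fst (l 4) * fst (p 1 3) + snd (l 4)"
        by (rule *[OF _ _ _ ne[of "p 1 4"]]; (rule pl neq)?) (use dist in auto)
      show "snd (p 1 2) \<noteq> fst (l 4) * fst (p 1 2) + snd (l 4)"
        by (rule *[OF _ _ _ ne[of "p 1 4"]]; (rule pl neq)?) (use dist in auto)
    qed (auto simp: frob_add power_mult_distrib)
  qed
next
  fix L L' a b assume "L \<in> secant ` secant_coeffs" "L' \<in> secant ` secant_coeffs" "a \<in> L \<inter> L'" "b \<in> L \<inter> L'" "a \<noteq> b"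
  then show "L = L'" using secant_meet by blast
next
  show "L \<subseteq> unital_points" if "L \<in> secant ` secant_coeffs" for L using that by (auto simp: secant_def)
qed (use q_ge_2 card_unital_points card_secant card_secant_coeffs in \<open>auto simp: card_image[OF inj_secant]\<close>)

end

lemma exists_dense_unital:
  assumes "s > 0"
  shows "\<exists>(P :: (bit alg_closure \<times> bit alg_closure) set) \<L>. dense_unital (2 ^ s) P \<L>"
proof -
  interpret binary_frobenius "2 ^ s" s "TYPE(bit alg_closure)"
    using assms by unfold_locales (auto simp: CHAR_bit)
  show ?thesis using dense_unital by blast
qed

subsection \<open>Random bipartitions of the pencils\<close>

lemma card_subsets_of_card_le:
  assumes "finite F"
  shows "card {A. A \<subseteq> F \<and> card A \<le> y} \<le> (card F + 1) ^ y"
proof (induction y)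
  case 0
  have "{A. A \<subseteq> F \<and> card A \<le> 0} = {{}}" using assms by (auto dest: finite_subset)
  then show ?case by simp
next
  case (Suc y)
  let ?S = "\<lambda>y. {A. A \<subseteq> F \<and> card A \<le> y}"
  \<comment> \<open>One further element, or none, is added: \<open>card F + 1\<close>
    choices.\<close>
  let ?T = "?S y \<times> insert {} ((\<lambda>x. {x}) ` F)"
  have fin: "finite ?T" using assms by auto
  have "?S (Suc y) \<subseteq> (\<lambda>(A, B). A \<union> B) ` ?T"
  proof
    fix A assume A: "A \<in> ?S (Suc y)"
    show "A \<in> (\<lambda>(A, B). A \<union> B) ` ?T"
    proof (cases "A = {}")
      case True
      then show ?thesis by (auto intro!: image_eqI[where x = "({}, {})"])
    next
      case False
      then obtain x where x: "x \<in> A" by blast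
      have "card (A - {x}) \<le> y" using A x assms by (auto simp: card_Diff_singleton)
      with A x show ?thesis by (intro image_eqI[where x = "(A - {x}, {x})"]) auto
    qed
  qed
  then have "card (?S (Suc y)) \<le> card ?T"
    using fin by (meson card_image_le card_mono finite_imageI le_trans)
  also have "\<dots> = card (?S y) * (card F + 1)"
  proof -
    have "{} \<notin> (\<lambda>x. {x}) ` F" by auto
    then show ?thesis using assms by (simp add: card_cartesian_product card_image)
  qed
  also have "\<dots> \<le> (card F + 1) ^ y * (card F + 1)"
    using Suc by (intro mult_right_mono) auto
  finally show ?case by (simp add: mult.commute)
qed

lemma card_prescribed_trace:
  assumes "finite U" "F \<subseteq> U" "finite Z"
  shows "card {\<kappa> \<in> Pow U. \<kappa> \<inter> F \<in> Z} \<le> card Z * 2 ^ (card U - card F)"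
proof -
  have "card {\<kappa> \<in> Pow U. \<kappa> \<inter> F \<in> Z} \<le> card (Z \<times> Pow (U - F))"
  proof (rule card_inj_on_le)
    show "inj_on (\<lambda>\<kappa>. (\<kappa> \<inter> F, \<kappa> - F)) {\<kappa> \<in> Pow U. \<kappa> \<inter> F \<in> Z}"
      by (rule inj_onI) blast
  qed (use assms in auto)
  also have "\<dots> = card Z * 2 ^ (card U - card F)"
    using assms by (simp add: card_cartesian_product card_Pow card_Diff_subset finite_subset)
  finally show ?thesis .
qed

lemma sum_power_card_Pow:
  fixes z :: "'a::comm_semiring_1"
  assumes "finite A"
  shows "(\<Sum>W\<in>Pow A. z ^ card W) = (z + 1) ^ card A"
  using prod_add[OF assms, of "\<lambda>_. z" "\<lambda>_. 1"] by simp

section \<open>Rich points, pencils and degree sums\<close>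

context dense_unital
begin

text \<open>A subset \<open>\<kappa>\<close> of the flags encodes one bipartition of every pencil:
  the side of \<open>L\<close> at \<open>p\<close> is whether \<open>(p, L)\<close> belongs to
  \<open>\<kappa>\<close>. A uniformly random subset is thus an independent random bipartition at
  each point.\<close>

definition flags :: "('p \<times> 'p set) set" where
  "flags = (SIGMA p:P. {L\<in>\<L>. p \<in> L})"

definition pencil :: "'p set set \<Rightarrow> 'p \<Rightarrow> 'p set set" where
  "pencil W p = {L\<in>W. p \<in> L}"

text \<open>Over at most \<open>q ^ 3\<close> points the average pencil inside \<open>W\<close> has
  size at least \<open>card W / q ^ 2\<close>; the threshold is half of that.\<close>

definition rich :: "'p set set \<Rightarrow> 'p set" where
  "rich W = {p\<in>P. card W \<le> 2 * q ^ 2 * card (pencil W p)}"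

definition mass :: "'p set set \<Rightarrow> nat" where
  "mass W = (\<Sum>p\<in>rich W. card (pencil W p))"

definition minority :: "('p \<times> 'p set) set \<Rightarrow> 'p set set \<Rightarrow> 'p \<Rightarrow> nat" where
  "minority \<kappa> W p = min (card {L\<in>pencil W p. (p, L) \<in> \<kappa>}) (card {L\<in>pencil W p. (p, L) \<notin> \<kappa>})"

definition adj :: "('p \<times> 'p set) set \<Rightarrow> 'p set \<Rightarrow> 'p set \<Rightarrow> bool" where
  "adj \<kappa> L L' \<longleftrightarrow> (\<exists>p\<in>L \<inter> L'. (p, L) \<in> \<kappa> \<longleftrightarrow> (p, L') \<notin> \<kappa>)"

lemma adj_sym: "adj \<kappa> L L' \<longleftrightarrow> adj \<kappa> L' L"
  by (auto simp: adj_def)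

lemma adj_irrefl: "\<not> adj \<kappa> L L"
  by (auto simp: adj_def)

lemma finite_blocks: "finite \<L>"
  using finite_P block_subset by (auto intro: finite_subset[of \<L> "Pow P"])

lemma finite_rich: "finite (rich W)"
  using finite_P by (simp add: rich_def)

lemma finite_flags: "finite flags"
  using finite_P finite_blocks by (simp add: flags_def)

lemma finite_pencil: "W \<subseteq> \<L> \<Longrightarrow> finite (pencil W p)"
  using finite_blocks by (auto simp: pencil_def intro: finite_subset)

lemma sum_card_pencil:
  assumes "W \<subseteq> \<L>"
  shows "(\<Sum>p\<in>P. card (pencil W p)) = card W * (q + 1)"
proof -
  have fX: "finite W" using assms finite_blocks by (rule finite_subset)
  have "(\<Sum>p\<in>P. card (pencil W p)) = (\<Sum>L\<in>W. card {p\<in>P. p \<in> L})"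
    using sum_multicount_gen[of P W "\<lambda>p L. p \<in> L" "\<lambda>L. card {p\<in>P. p \<in> L}"] finite_P fX
    by (simp add: pencil_def)
  also have "\<dots> = (\<Sum>L\<in>W. q + 1)"
  proof (rule sum.cong)
    fix L assume "L \<in> W"
    then have "L \<in> \<L>" using assms by blast
    then have "{p\<in>P. p \<in> L} = L" using block_subset by blast
    then show "card {p\<in>P. p \<in> L} = q + 1" using card_block \<open>L \<in> \<L>\<close> by simp
  qed simp
  finally show ?thesis by simp
qed

text \<open>Of the \<open>card W * (q + 1)\<close> flags, the at most \<open>q ^ 3\<close> points
  that are not rich carry at most \<open>card W / (2 * q ^ 2)\<close> each, hence at most
  \<open>q * card W / 2\<close> in total.\<close>

lemma mass_ge:
  assumes "W \<subseteq> \<L>"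
  shows "card W * q \<le> 2 * mass W"
proof -
  let ?c = "\<lambda>p. card (pencil W p)"
  have "2 * q ^ 2 * (\<Sum>p\<in>P - rich W. ?c p) \<le> (\<Sum>p\<in>P - rich W. card W)"
    unfolding sum_distrib_left by (rule sum_mono) (auto simp: rich_def)
  also have "\<dots> = card (P - rich W) * card W" by simp
  also have "\<dots> \<le> q ^ 3 * card W"
    using card_mono[of P "P - rich W"] finite_P card_P by (intro mult_right_mono) auto
  finally have "q ^ 2 * (2 * (\<Sum>p\<in>P - rich W. ?c p)) \<le> q ^ 2 * (q * card W)"
    by (simp add: power2_eq_square power3_eq_cube mult_ac)
  then have "2 * (\<Sum>p\<in>P - rich W. ?c p) \<le> q * card W"
    using q_ge_2 by simp
  moreover have "(\<Sum>p\<in>P - rich W. ?c p) + mass W = card W * (q + 1)"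
    unfolding mass_def sum_card_pencil[OF assms, symmetric]
    by (rule sum.subset_diff[symmetric]) (use finite_P in \<open>auto simp: rich_def\<close>)
  ultimately have "2 * (card W * (q + 1)) \<le> q * card W + 2 * mass W" by linarith
  then show ?thesis by (simp add: algebra_simps)
qed

text \<open>A crude bound that later turns a power of \<open>mass W + 1\<close> into a power of two
  with exponent linear in \<open>s\<close>.\<close>

lemma mass_le:
  assumes "W \<subseteq> \<L>"
  shows "mass W + 1 \<le> q ^ 6"
proof -
  have "mass W \<le> card W * (q + 1)"
    unfolding mass_def sum_card_pencil[OF assms, symmetric]
    by (rule sum_mono2) (use finite_P in \<open>auto simp: rich_def\<close>)
  also have "\<dots> \<le> q ^ 4 * (q + 1)"
    using card_mono[OF finite_blocks assms] card_blocks by (intro mult_right_mono) auto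
  finally have "mass W + 1 \<le> q ^ 4 * (q + 1) + q ^ 4"
    using one_le_power[of q 4] q_ge_2 by linarith
  also have "\<dots> = q ^ 4 * (q + 2)" by (simp add: algebra_simps)
  also have "\<dots> \<le> q ^ 4 * (q * q)"
  proof -
    have "q + 2 \<le> 2 * q" using q_ge_2 by simp
    also have "\<dots> \<le> q * q" using q_ge_2 by (intro mult_right_mono) auto
    finally show ?thesis by (rule mult_left_mono) simp
  qed
  also have "\<dots> = q ^ 6" by (simp add: eval_nat_numeral)
  finally show ?thesis .
qed

text \<open>For \<open>W\<close> this large, being rich forces a pencil of at least four lines.
  Choosing a majority side at each rich point therefore costs at most a quarter of the available
  \<open>mass W\<close> bits.\<close>

lemma card_rich_le:
  assumes "8 * q ^ 2 \<le> card W"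
  shows "4 * card (rich W) \<le> mass W"
proof -
  have "8 * q ^ 2 * card (rich W) \<le> card W * card (rich W)"
    using assms by (rule mult_right_mono) simp
  also have "\<dots> = (\<Sum>p\<in>rich W. card W)" by simp
  also have "\<dots> \<le> 2 * q ^ 2 * mass W"
    unfolding mass_def sum_distrib_left by (rule sum_mono) (simp add: rich_def)
  finally have "2 * q ^ 2 * (4 * card (rich W)) \<le> 2 * q ^ 2 * mass W" by simp
  then show ?thesis using q_ge_2 by simp
qed

text \<open>A pencil split into sides of sizes \<open>a\<close> and \<open>b\<close> yields
  \<open>2 * a * b\<close> ordered adjacent pairs, at least \<open>(a + b) * min a b\<close>. Pairs
  from different points are different, since two lines meet at most once.\<close>

lemma minority_le_degree_sum:
  assumes "W \<subseteq> \<L>"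
  shows "(\<Sum>p\<in>rich W. card (pencil W p) * minority \<kappa> W p) \<le> (\<Sum>L\<in>W. card {L'\<in>W. adj \<kappa> L L'})"
proof -
  have fX: "finite W" using assms finite_blocks by (rule finite_subset)
  define A where "A p = {L\<in>pencil W p. (p, L) \<in> \<kappa>}" for p
  define B where "B p = {L\<in>pencil W p. (p, L) \<notin> \<kappa>}" for p
  define D where "D p = A p \<times> B p \<union> B p \<times> A p" for p
  have fin: "finite (A p)" "finite (B p)" for p
    using finite_pencil[OF assms] by (auto simp: A_def B_def)
  have disj: "A p \<inter> B p = {}" for p by (auto simp: A_def B_def)
  have "card (pencil W p) * minority \<kappa> W p \<le> card (D p)" for p
  proof -
    have "pencil W p = A p \<union> B p" by (auto simp: A_def B_def)
    then have "card (pencil W p) = card (A p) + card (B p)"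
      using card_Un_disjoint[OF fin disj] by simp
    moreover have "minority \<kappa> W p = min (card (A p)) (card (B p))"
      by (simp add: minority_def A_def B_def)
    moreover have "card (D p) = card (A p) * card (B p) + card (B p) * card (A p)"
      unfolding D_def using disj[of p] fin
      by (subst card_Un_disjoint) (auto simp: card_cartesian_product)
    moreover have "(a + b) * min a b \<le> a * b + b * a" for a b :: nat
    proof -
      have "a * min a b \<le> a * b" "b * min a b \<le> b * a" by (auto intro!: mult_left_mono)
      then show ?thesis unfolding distrib_right by (rule add_mono)
    qed
    ultimately show ?thesis by simp
  qed
  then have "(\<Sum>p\<in>rich W. card (pencil W p) * minority \<kappa> W p) \<le> (\<Sum>p\<in>rich W. card (D p))"
    by (rule sum_mono)
  also have "\<dots> = card (\<Union>p\<in>rich W. D p)"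
  proof (rule card_UN_disjoint[symmetric])
    show "\<forall>i\<in>rich W. \<forall>j\<in>rich W. i \<noteq> j \<longrightarrow> D i \<inter> D j = {}"
    proof (intro ballI impI)
      fix i j :: 'p assume "i \<noteq> j"
      have False if "(L, L') \<in> D i" "(L, L') \<in> D j" for L L'
      proof -
        have "L \<in> \<L>" "L' \<in> \<L>" "i \<in> L \<inter> L'" "j \<in> L \<inter> L'" "L \<noteq> L'"
          using that assms by (auto simp: D_def A_def B_def pencil_def)
        then show False using meet_once \<open>i \<noteq> j\<close> by blast
      qed
      then show "D i \<inter> D j = {}" by auto
    qed
  qed (auto simp: D_def fin finite_rich)
  also have "\<dots> \<le> card (SIGMA L:W. {L'\<in>W. adj \<kappa> L L'})"
    by (rule card_mono) (use fX in \<open>auto simp: D_def A_def B_def pencil_def adj_def\<close>)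
  also have "\<dots> = (\<Sum>L\<in>W. card {L'\<in>W. adj \<kappa> L L'})"
    using fX by (subst card_SigmaI) auto
  finally show ?thesis .
qed

text \<open>
  A colouring with few minority flags agrees on the rich flags of \<open>W\<close> with a majority colour per
  point, up to a small set of exceptions.
\<close>
lemma card_unbalanced:
  assumes "W \<subseteq> \<L>"
  shows "card {\<kappa> \<in> Pow flags. (\<Sum>p\<in>rich W. minority \<kappa> W p) \<le> y} * 2 ^ mass W
       \<le> 2 ^ card (rich W) * (mass W + 1) ^ y * 2 ^ card flags"
proof -
  define F where "F = (SIGMA p:rich W. pencil W p)"
  have card_F: "card F = mass W"
    unfolding F_def mass_def using finite_rich finite_pencil[OF assms] by (subst card_SigmaI) auto
  have F: "F \<subseteq> flags" using assms by (auto simp: F_def flags_def rich_def pencil_def)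
  have fF: "finite F" using F finite_flags by (rule finite_subset)
  \<comment> \<open>\<open>g\<close> rebuilds the colouring on \<open>F\<close> from the set
    \<open>R\<close> of points whose majority lies in the colouring and the set \<open>A\<close> of
    minority flags.\<close>
  define g where "g = (\<lambda>(R, A). {f\<in>F. fst f \<in> R \<longleftrightarrow> f \<notin> A})"
  define Z where "Z = g ` (Pow (rich W) \<times> {A. A \<subseteq> F \<and> card A \<le> y})"
  have fin: "finite (Pow (rich W) \<times> {A. A \<subseteq> F \<and> card A \<le> y})"
    using finite_rich fF by auto
  have "card Z \<le> card (Pow (rich W) \<times> {A. A \<subseteq> F \<and> card A \<le> y})"
    unfolding Z_def using fin by (rule card_image_le)
  also have "\<dots> \<le> 2 ^ card (rich W) * (mass W + 1) ^ y"
    using card_subsets_of_card_le[OF fF, of y] finite_rich card_F by (simp add: card_cartesian_product card_Pow)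
  finally have cZ: "card Z \<le> 2 ^ card (rich W) * (mass W + 1) ^ y" .
  have "{\<kappa> \<in> Pow flags. (\<Sum>p\<in>rich W. minority \<kappa> W p) \<le> y} \<subseteq> {\<kappa> \<in> Pow flags. \<kappa> \<inter> F \<in> Z}"
  proof
    fix \<kappa> assume \<kappa>: "\<kappa> \<in> {\<kappa> \<in> Pow flags. (\<Sum>p\<in>rich W. minority \<kappa> W p) \<le> y}"
    define R where "R = {p\<in>rich W. card {L\<in>pencil W p. (p, L) \<notin> \<kappa>} \<le> card {L\<in>pencil W p. (p, L) \<in> \<kappa>}}"
    define A where "A = (SIGMA p:rich W. {L\<in>pencil W p. p \<in> R \<longleftrightarrow> (p, L) \<notin> \<kappa>})"
    have "card A = (\<Sum>p\<in>rich W. card {L\<in>pencil W p. p \<in> R \<longleftrightarrow> (p, L) \<notin> \<kappa>})"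
      unfolding A_def using finite_rich finite_pencil[OF assms] by (subst card_SigmaI) auto
    also have "\<dots> = (\<Sum>p\<in>rich W. minority \<kappa> W p)"
    proof (rule sum.cong[OF refl])
      fix p assume "p \<in> rich W"
      then show "card {L\<in>pencil W p. p \<in> R \<longleftrightarrow> (p, L) \<notin> \<kappa>} = minority \<kappa> W p"
        by (cases "p \<in> R") (auto simp: R_def minority_def)
    qed
    finally have "card A \<le> y" using \<kappa> by simp
    moreover have "\<kappa> \<inter> F = g (R, A)" by (auto simp: g_def F_def A_def)
    ultimately have "\<kappa> \<inter> F \<in> Z"
      unfolding Z_def by (intro image_eqI[where x = "(R, A)"]) (auto simp: R_def A_def F_def)
    with \<kappa> show "\<kappa> \<in> {\<kappa> \<in> Pow flags. \<kappa> \<inter> F \<in> Z}" by simp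
  qed
  then have "card {\<kappa> \<in> Pow flags. (\<Sum>p\<in>rich W. minority \<kappa> W p) \<le> y} \<le> card {\<kappa> \<in> Pow flags. \<kappa> \<inter> F \<in> Z}"
    using finite_flags by (intro card_mono) auto
  also have "\<dots> \<le> card Z * 2 ^ (card flags - card F)"
    using finite_flags F fin by (intro card_prescribed_trace) (auto simp: Z_def)
  also have "\<dots> \<le> (2 ^ card (rich W) * (mass W + 1) ^ y) * 2 ^ (card flags - mass W)"
    using cZ card_F by (intro mult_mono) auto
  finally have "card {\<kappa> \<in> Pow flags. (\<Sum>p\<in>rich W. minority \<kappa> W p) \<le> y} * 2 ^ mass W
     \<le> (2 ^ card (rich W) * (mass W + 1) ^ y) * (2 ^ (card flags - mass W) * 2 ^ mass W)"
    by (metis (no_types, lifting) mult.assoc mult_le_mono1)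
  moreover have "mass W \<le> card flags"
    using card_mono[OF finite_flags F] card_F by simp
  ultimately show ?thesis by (simp flip: power_add)
qed


section \<open>Balanced colourings and supersaturation\<close>

lemma card_unbalanced_le:
  assumes q: "q = 2 ^ s" "s \<ge> 2" and W: "W \<subseteq> \<L>" "8 * q ^ 2 \<le> card W"
  shows "card {\<kappa> \<in> Pow flags. (\<Sum>p\<in>rich W. minority \<kappa> W p) \<le> mass W div (24 * s)}
       * 2 ^ (2 ^ (s - 2) * card W) \<le> 2 ^ card flags"
    (is "card ?B * _ \<le> _")
proof -
  define y where "y = mass W div (24 * s)"
  \<comment> \<open>By \<open>mass_le\<close> the exceptions cost \<open>6 * s * y\<close> bits, at
    most \<open>mass W / 4\<close> by the choice of \<open>y\<close>; the majority sides cost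
    another quarter. The remaining half of \<open>mass W\<close> is at least
    \<open>q * card W / 4 = 2 ^ (s - 2) * card W\<close>.\<close>
  define e where "e = card (rich W) + 6 * s * y"
  have "24 * s * y \<le> mass W" unfolding y_def by (rule times_div_less_eq_dividend)
  then have "2 * e \<le> mass W"
    using card_rich_le[OF W(2)] unfolding e_def by simp
  moreover have "2 * (2 ^ (s - 2) * card W) \<le> mass W"
  proof -
    obtain r where "s = Suc (Suc r)" using q(2) by (metis add_2_eq_Suc le_Suc_ex)
    then have "card W * q = 2 * (2 * (2 ^ (s - 2) * card W))" using q(1) by simp
    then show ?thesis using mass_ge[OF W(1)] by linarith
  qed
  ultimately have le: "e + 2 ^ (s - 2) * card W \<le> mass W" by simp
  have "(mass W + 1) ^ y \<le> (q ^ 6) ^ y" using mass_le[OF W(1)] by (rule power_mono) simp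
  also have "\<dots> = 2 ^ (6 * s * y)" unfolding q(1) by (simp add: mult_ac flip: power_mult)
  finally have "2 ^ card (rich W) * (mass W + 1) ^ y \<le> 2 ^ e"
    unfolding e_def power_add by (rule mult_left_mono) simp
  then have "card ?B * 2 ^ mass W \<le> 2 ^ e * 2 ^ card flags"
    using card_unbalanced[OF W(1), of y] unfolding y_def by (meson le_trans mult_le_mono1)
  moreover have "card ?B * 2 ^ (e + 2 ^ (s - 2) * card W) \<le> card ?B * 2 ^ mass W"
    using le by (intro mult_left_mono power_increasing) auto
  ultimately have "card ?B * 2 ^ (e + 2 ^ (s - 2) * card W) \<le> 2 ^ e * 2 ^ card flags"
    by (rule le_trans[rotated])
  then have "2 ^ e * (card ?B * 2 ^ (2 ^ (s - 2) * card W)) \<le> 2 ^ e * 2 ^ card flags"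
    by (simp only: power_add mult_ac)
  then show ?thesis by simp
qed

text \<open>Union bound: each large \<open>W\<close> fails with probability at most
  \<open>z ^ card W\<close>, and the sum over all nonempty sets of lines is
  \<open>(z + 1) ^ card \<L> - 1\<close>, which is below 1.\<close>

lemma exists_balanced_colouring:
  assumes q: "q = 2 ^ s" "s \<ge> 2" "4 * s + 1 \<le> 2 ^ (s - 2)"
  shows "\<exists>\<kappa>. \<forall>W\<subseteq>\<L>. 8 * q ^ 2 \<le> card W \<longrightarrow> mass W \<le> 24 * s * (\<Sum>p\<in>rich W. minority \<kappa> W p)"
proof -
  define bad where "bad W = {\<kappa> \<in> Pow flags. (\<Sum>p\<in>rich W. minority \<kappa> W p) \<le> mass W div (24 * s)}" for W
  define \<X> where "\<X> = {W\<in>Pow \<L>. 8 * q ^ 2 \<le> card W}"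
  define z :: real where "z = 1 / 2 ^ 2 ^ (s - 2)"
  have fin\<X>: "finite \<X>" using finite_blocks by (simp add: \<X>_def)
  have sub: "\<X> \<subseteq> Pow \<L> - {{}}" using q_ge_2 by (auto simp: \<X>_def)
  have z0: "z \<ge> 0" by (simp add: z_def)
  \<comment> \<open>This is where \<open>4 * s + 1 \<le> 2 ^ (s - 2)\<close> enters, against the at
    most \<open>2 ^ (4 * s)\<close> lines.\<close>
  have nz: "card \<L> * z \<le> 1 / 2"
  proof -
    have "real (card \<L>) \<le> 2 ^ (4 * s)"
      using card_blocks(2) unfolding q(1) by (metis (mono_tags) mult.commute of_nat_le_iff of_nat_numeral of_nat_power power_mult)
    moreover have "z \<le> 1 / 2 ^ (4 * s + 1)"
      unfolding z_def using q(3) by (intro divide_left_mono power_increasing) auto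
    ultimately have "card \<L> * z \<le> 2 ^ (4 * s) * (1 / 2 ^ (4 * s + 1))"
      using z0 by (intro mult_mono) auto
    then show ?thesis by simp
  qed
  have "real (card (\<Union>W\<in>\<X>. bad W)) \<le> (\<Sum>W\<in>\<X>. real (card (bad W)))"
    using card_UN_le[OF fin\<X>, of bad] by (metis of_nat_mono of_nat_sum)
  also have "\<dots> \<le> (\<Sum>W\<in>\<X>. 2 ^ card flags * z ^ card W)"
  proof (rule sum_mono)
    fix W assume "W \<in> \<X>"
    then have "card (bad W) * 2 ^ (2 ^ (s - 2) * card W) \<le> 2 ^ card flags"
      unfolding bad_def \<X>_def using card_unbalanced_le[OF q(1,2)] by simp
    then have "real (card (bad W)) * 2 ^ (2 ^ (s - 2) * card W) \<le> 2 ^ card flags"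
      by (metis (mono_tags, lifting) of_nat_le_iff of_nat_mult of_nat_numeral of_nat_power)
    then show "real (card (bad W)) \<le> 2 ^ card flags * z ^ card W"
      unfolding z_def by (simp add: power_divide field_simps flip: power_mult)
  qed
  also have "\<dots> \<le> (\<Sum>W\<in>Pow \<L> - {{}}. 2 ^ card flags * z ^ card W)"
    using sub z0 finite_blocks by (intro sum_mono2) auto
  also have "\<dots> = 2 ^ card flags * ((z + 1) ^ card \<L> - 1)"
    using finite_blocks by (simp add: sum_diff1 sum_power_card_Pow flip: sum_distrib_left)
  also have "\<dots> < 2 ^ card flags * 1"
  proof -
    have "(z + 1) ^ card \<L> \<le> exp z ^ card \<L>"
      using z0 exp_ge_add_one_self[of z] by (intro power_mono) (auto simp: add.commute)
    also have "\<dots> = exp (card \<L> * z)" by (simp add: exp_of_nat_mult)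
    also have "\<dots> \<le> 1 + card \<L> * z + (card \<L> * z)\<^sup>2"
      using nz z0 by (intro exp_bound) auto
    also have "\<dots> \<le> 1 + 1 / 2 + (1 / 2)\<^sup>2"
      using nz z0 by (intro add_mono power_mono) auto
    finally have "(z + 1) ^ card \<L> - 1 < 1" by (simp add: power2_eq_square)
    then show ?thesis by (intro mult_strict_left_mono) auto
  qed
  finally have "card (\<Union>W\<in>\<X>. bad W) < card (Pow flags)"
    using finite_flags by (simp add: card_Pow)
  have "\<not> Pow flags \<subseteq> (\<Union>W\<in>\<X>. bad W)"
  proof -
    have "finite (\<Union>W\<in>\<X>. bad W)"
      by (rule finite_subset[of _ "Pow flags"]) (use finite_flags in \<open>auto simp: bad_def\<close>)
    then show ?thesis using \<open>card (\<Union>W\<in>\<X>. bad W) < card (Pow flags)\<close> card_mono leD by blast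
  qed
  then obtain \<kappa> where \<kappa>: "\<kappa> \<in> Pow flags" "\<And>W. W \<in> \<X> \<Longrightarrow> \<kappa> \<notin> bad W" by blast
  have "mass W \<le> 24 * s * (\<Sum>p\<in>rich W. minority \<kappa> W p)" if "W \<in> \<X>" for W
  proof -
    \<comment> \<open>Strictly exceeding the rounded-down quotient gives the multiplied inequality
      without rounding loss.\<close>
    have "mass W div (24 * s) < (\<Sum>p\<in>rich W. minority \<kappa> W p)"
      using \<kappa>(1) \<kappa>(2)[OF that] unfolding bad_def by auto
    then have "mass W < (\<Sum>p\<in>rich W. minority \<kappa> W p) * (24 * s)"
      using q(2) by (subst (asm) div_less_iff_less_mult) auto
    then show ?thesis by (simp add: mult.commute)
  qed
  then show ?thesis unfolding \<X>_def by blast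
qed

text \<open>If all degrees were small, so would be the degree sum. The constant is
  \<open>96 = 2 * 24 * 2\<close>: from \<open>mass_ge\<close>, from the balance of the colouring,
  and from the threshold of \<open>rich\<close>.\<close>

theorem exists_supersaturated:
  assumes q: "q = 2 ^ s" "s \<ge> 2" "4 * s + 1 \<le> 2 ^ (s - 2)"
  shows "\<exists>\<kappa>. \<forall>W\<subseteq>\<L>. 8 * q ^ 2 \<le> card W \<longrightarrow>
    (\<exists>L\<in>W. card W \<le> 96 * s * q * card {L'\<in>W. adj \<kappa> L L'})"
proof -
  obtain \<kappa> where \<kappa>: "\<And>W. W \<subseteq> \<L> \<Longrightarrow> 8 * q ^ 2 \<le> card W \<Longrightarrow>
      mass W \<le> 24 * s * (\<Sum>p\<in>rich W. minority \<kappa> W p)"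
    using exists_balanced_colouring[OF q] by blast
  have "\<exists>L\<in>W. card W \<le> 96 * s * q * card {L'\<in>W. adj \<kappa> L L'}"
    if W: "W \<subseteq> \<L>" "8 * q ^ 2 \<le> card W" for W
  proof (rule ccontr)
    assume "\<not> (\<exists>L\<in>W. card W \<le> 96 * s * q * card {L'\<in>W. adj \<kappa> L L'})"
    then have less: "96 * s * q * card {L'\<in>W. adj \<kappa> L L'} < card W" if "L \<in> W" for L
      using that by (simp add: not_le)
    have fX: "finite W" using W(1) finite_blocks by (rule finite_subset)
    have "W \<noteq> {}" using W(2) q_ge_2 by auto
    let ?D = "\<Sum>L\<in>W. card {L'\<in>W. adj \<kappa> L L'}"
    have "96 * s * q * ?D < (\<Sum>L\<in>W. card W)"
      unfolding sum_distrib_left using fX \<open>W \<noteq> {}\<close> less by (rule sum_strict_mono)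
    then have "96 * s * q * ?D < card W * card W" by simp
    then have "q * (96 * s * q * ?D) < q * (card W * card W)"
      using q_ge_2 by (intro mult_strict_left_mono) auto
    also have "\<dots> \<le> card W * (2 * mass W)"
      using mass_ge[OF W(1)] by (metis mult.assoc mult.commute mult_le_mono2)
    also have "\<dots> \<le> card W * (2 * (24 * s * (\<Sum>p\<in>rich W. minority \<kappa> W p)))"
      using \<kappa>[OF W] by (intro mult_left_mono) auto
    also have "\<dots> = 48 * s * (\<Sum>p\<in>rich W. card W * minority \<kappa> W p)"
      by (simp add: sum_distrib_left mult_ac)
    also have "\<dots> \<le> 48 * s * (\<Sum>p\<in>rich W. (2 * q ^ 2 * card (pencil W p)) * minority \<kappa> W p)"
      by (intro mult_left_mono sum_mono mult_right_mono) (auto simp: rich_def)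
    also have "\<dots> = 96 * s * q ^ 2 * (\<Sum>p\<in>rich W. card (pencil W p) * minority \<kappa> W p)"
      by (simp add: sum_distrib_left mult_ac)
    also have "\<dots> \<le> 96 * s * q ^ 2 * ?D"
      using minority_le_degree_sum[OF W(1)] by (rule mult_left_mono) simp
    finally show False by (simp add: power2_eq_square mult_ac)
  qed
  then show ?thesis by blast
qed

text \<open>Pairwise adjacent lines are never three through one point, because two of them would be
  on the same side there. So four of them have six distinct meeting points, an O'Nan
  configuration.\<close>

lemma adj_K4_free:
  assumes S: "S \<subseteq> \<L>" "card S = 4"
  shows "\<exists>L\<in>S. \<exists>L'\<in>S. L \<noteq> L' \<and> \<not> adj \<kappa> L L'"
proof (rule ccontr)
  assume "\<not> ?thesis"
  then have adj: "adj \<kappa> L L'" if "L \<in> S" "L' \<in> S" "L \<noteq> L'" for L L'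
    using that by blast
  have "finite S" using S(2) by (intro card_ge_0_finite) simp
  then obtain B where B: "bij_betw B {1..4::nat} S"
    using ex_bij_betw_nat_finite_1 S(2) by metis
  have inj: "inj_on B {1..4}" using B by (auto simp: bij_betw_def)
  have BS: "B i \<in> S" if "1 \<le> i" "i \<le> 4" for i
    using that B by (auto simp: bij_betw_def)
  have BL: "B i \<in> \<L>" if "1 \<le> i" "i \<le> 4" for i using BS[OF that] S by blast
  have Bne: "B i \<noteq> B j" if "1 \<le> i" "i < j" "j \<le> 4" for i j
    using inj_onD[OF inj, of i j] that by auto
  have adjB: "adj \<kappa> (B i) (B j)" if "1 \<le> i" "i < j" "j \<le> 4" for i j
    using that by (intro adj BS Bne) auto
  define p where "p i j = (SOME p. p \<in> B i \<inter> B j \<and> ((p, B i) \<in> \<kappa> \<longleftrightarrow> (p, B j) \<notin> \<kappa>))" for i j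
  have p: "p i j \<in> B i \<inter> B j \<and> ((p i j, B i) \<in> \<kappa> \<longleftrightarrow> (p i j, B j) \<notin> \<kappa>)"
    if "1 \<le> i" "i < j" "j \<le> 4" for i j
    unfolding p_def by (rule someI_ex) (use adjB[OF that] in \<open>auto simp: adj_def\<close>)
  have uniq: "a = p i j" if "1 \<le> i" "i < j" "j \<le> 4" "a \<in> B i" "a \<in> B j" for i j a
    using meet_once[OF BL BL, of i j a "p i j"] p[OF that(1-3)] Bne[OF that(1-3)] that by auto
  have tri: "\<not> (a \<in> B i \<and> a \<in> B j \<and> a \<in> B k)" if "1 \<le> i" "i < j" "j < k" "k \<le> 4" for i j k a
  proof
    assume a: "a \<in> B i \<and> a \<in> B j \<and> a \<in> B k"
    then have "a = p i j" "a = p j k" "a = p i k"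
      using that by (auto intro!: uniq)
    then show False using p[of i j] p[of j k] p[of i k] that by auto
  qed
  have mem: "p i j \<in> B i" "p i j \<in> B j" if "1 \<le> i" "i < j" "j \<le> 4" for i j
    using p[OF that] by auto
  note m = mem[of 1 2] mem[of 1 3] mem[of 1 4] mem[of 2 3] mem[of 2 4] mem[of 3 4]
  have t: "\<not> (a \<in> B 1 \<and> a \<in> B 2 \<and> a \<in> B 3)" "\<not> (a \<in> B 1 \<and> a \<in> B 2 \<and> a \<in> B 4)"
     "\<not> (a \<in> B 1 \<and> a \<in> B 3 \<and> a \<in> B 4)" "\<not> (a \<in> B 2 \<and> a \<in> B 3 \<and> a \<in> B 4)" for a
    by (rule tri; simp)+
  have "distinct [p 1 2, p 1 3, p 1 4, p 2 3, p 2 4, p 3 4]"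
    using m t[of "p 1 2"] t[of "p 1 3"] t[of "p 1 4"] t[of "p 2 3"] t[of "p 2 4"] t[of "p 3 4"] by auto
  moreover have "\<not> distinct [p 1 2, p 1 3, p 1 4, p 2 3, p 2 4, p 3 4]"
    by (rule onan_free[of B]) (use BL p inj in auto)
  ultimately show False by blast
qed

end

subsection \<open>Containers and random maps\<close>

definition independent_in :: "('v \<Rightarrow> 'v \<Rightarrow> bool) \<Rightarrow> 'v set \<Rightarrow> bool" where
  "independent_in adj I \<longleftrightarrow> (\<forall>u\<in>I. \<forall>v\<in>I. u \<noteq> v \<longrightarrow> \<not> adj u v)"

text \<open>Branch on a vertex \<open>v\<close> of high degree. Independent sets avoiding
  \<open>v\<close> live in \<open>W - {v}\<close>; those containing it live, apart from
  \<open>v\<close>, among its non-neighbours, a set smaller by the factor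
  \<open>1 - \<beta>\<close>. Thus \<open>l\<close> is the number of selections still allowed, and
  the final container is a remainder below \<open>R\<close> plus the selected vertices.\<close>

lemma kleitman_winston_containers:
  fixes \<beta> :: real
  assumes "finite V" "0 \<le> \<beta>" "\<beta> \<le> 1"
    and deg: "\<And>W. W \<subseteq> V \<Longrightarrow> R \<le> card W \<Longrightarrow> \<exists>v\<in>W. \<beta> * card W \<le> card {w\<in>W. adj v w}"
    and W: "W \<subseteq> V" "card W * (1 - \<beta>) ^ l < R"
  shows "\<exists>\<C>. finite \<C> \<and> card \<C> \<le> (card W + 1) ^ l \<and> (\<forall>C\<in>\<C>. C \<subseteq> V \<and> card C \<le> R + l)
      \<and> (\<forall>I\<subseteq>W. independent_in adj I \<longrightarrow> (\<exists>C\<in>\<C>. I \<subseteq> C))"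
  using W
proof (induction "card W" arbitrary: W l rule: less_induct)
  case less
  have fX: "finite W" using less.prems(1) assms(1) by (rule finite_subset)
  show ?case
  proof (cases "card W < R")
    case True
    then show ?thesis using less.prems(1) by (intro exI[of _ "{W}"]) auto
  next
    case False
    \<comment> \<open>With \<open>card W\<close> at least \<open>R\<close>, the hypothesis on
      \<open>W\<close> rules out \<open>l = 0\<close>.\<close>
    then obtain l' where l: "l = Suc l'" using less.prems(2) by (cases l) auto
    obtain v where v: "v \<in> W" "\<beta> * card W \<le> card {w\<in>W. adj v w}"
      using deg[OF less.prems(1)] False by auto
    define Y where "Y = {w\<in>W. \<not> adj v w} - {v}"
    have Y: "Y \<subset> W" using v(1) by (auto simp: Y_def)
    have cY: "card Y < card W" using psubset_card_mono[OF fX Y] .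
    have "card {w\<in>W. adj v w} + card Y \<le> card W"
    proof -
      have "card {w\<in>W. adj v w} + card Y = card ({w\<in>W. adj v w} \<union> Y)"
        using fX by (subst card_Un_disjoint) (auto simp: Y_def)
      also have "\<dots> \<le> card W" using fX by (intro card_mono) (auto simp: Y_def)
      finally show ?thesis .
    qed
    then have "card Y \<le> (1 - \<beta>) * card W" using v(2) by (simp add: algebra_simps)
    then have "card Y * (1 - \<beta>) ^ l' \<le> (1 - \<beta>) * card W * (1 - \<beta>) ^ l'"
      using assms(3) by (intro mult_right_mono) auto
    also have "\<dots> < R" using less.prems(2) l by (simp add: mult_ac)
    finally have "card Y * (1 - \<beta>) ^ l' < R" .
    from less.hyps[OF cY subset_trans[OF psubset_imp_subset[OF Y] less.prems(1)] this]
    obtain \<D> where \<D>: "finite \<D>" "card \<D> \<le> (card Y + 1) ^ l'"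
        "\<forall>C\<in>\<D>. C \<subseteq> V \<and> card C \<le> R + l'"
        "\<forall>I\<subseteq>Y. independent_in adj I \<longrightarrow> (\<exists>C\<in>\<D>. I \<subseteq> C)"
      by (elim exE conjE) (rule that)
    have cX: "card (W - {v}) < card W" using fX v(1) by (meson card_Diff1_less)
    have "card (W - {v}) * (1 - \<beta>) ^ l \<le> card W * (1 - \<beta>) ^ l"
      using cX assms(3) by (intro mult_right_mono) auto
    then have "card (W - {v}) * (1 - \<beta>) ^ l < R" using less.prems(2) by linarith
    from less.hyps[OF cX subset_trans[OF Diff_subset less.prems(1)] this]
    obtain \<E> where \<E>: "finite \<E>" "card \<E> \<le> (card (W - {v}) + 1) ^ l"
        "\<forall>C\<in>\<E>. C \<subseteq> V \<and> card C \<le> R + l"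
        "\<forall>I\<subseteq>W - {v}. independent_in adj I \<longrightarrow> (\<exists>C\<in>\<E>. I \<subseteq> C)"
      by (elim exE conjE) (rule that)
    \<comment> \<open>Both branches have fewer than \<open>card W\<close> vertices, so the
      recurrence \<open>m ^ l + m ^ (l - 1) \<le> (m + 1) ^ l\<close> closes the induction.\<close>
    have "card (\<E> \<union> insert v ` \<D>) \<le> card W ^ l + card W ^ l'"
    proof -
      have "card (insert v ` \<D>) \<le> card W ^ l'"
        using card_image_le[OF \<D>(1), of "insert v"] \<D>(2) power_mono[of "card Y + 1" "card W" l'] cY
        by linarith
      moreover have "card \<E> \<le> card W ^ l"
      proof -
        have "card (W - {v}) + 1 = card W" using card_Suc_Diff1[OF fX v(1)] by simp
        then show ?thesis using \<E>(2) by simp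
      qed
      ultimately show ?thesis using card_Un_le[of \<E> "insert v ` \<D>"] by linarith
    qed
    also have "\<dots> \<le> (card W + 1) ^ l"
    proof -
      have "card W ^ l + card W ^ l' = (card W + 1) * card W ^ l'" by (simp add: l)
      also have "\<dots> \<le> (card W + 1) * (card W + 1) ^ l'" by (intro mult_left_mono power_mono) auto
      finally show ?thesis by (simp add: l)
    qed
    finally have "card (\<E> \<union> insert v ` \<D>) \<le> (card W + 1) ^ l" .
    moreover have "C \<subseteq> V \<and> card C \<le> R + l" if "C \<in> \<E> \<union> insert v ` \<D>" for C
      using that
    proof
      assume "C \<in> insert v ` \<D>"
      then obtain D where D: "C = insert v D" "D \<in> \<D>" by blast
      then have "card C \<le> Suc (card D)" using \<D>(3) assms(1) by (auto intro!: card_insert_le_m1)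
      then show ?thesis using D bspec[OF \<D>(3) D(2)] l v(1) less.prems(1) by auto
    qed (use \<E>(3) in auto)
    moreover have "\<exists>C\<in>\<E> \<union> insert v ` \<D>. I \<subseteq> C" if I: "I \<subseteq> W" "independent_in adj I" for I
    proof (cases "v \<in> I")
      case True
      have "I - {v} \<subseteq> Y" "independent_in adj (I - {v})"
        using I True by (auto simp: Y_def independent_in_def)
      then obtain D where "D \<in> \<D>" "I - {v} \<subseteq> D" using \<D>(4) by metis
      then show ?thesis by (intro bexI[of _ "insert v D"]) auto
    next
      case False
      then have "I \<subseteq> W - {v}" using I by blast
      then obtain C where "C \<in> \<E>" "I \<subseteq> C" using \<E>(4) I(2) by metis
      then show ?thesis by (intro bexI[of _ C]) auto
    qed
    ultimately show ?thesis
      using \<D>(1) \<E>(1) by (intro exI[of _ "\<E> \<union> insert v ` \<D>"] conjI ballI allI impI) auto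
  qed
qed

section \<open>Random maps and the product colouring\<close>

lemma exists_map_avoiding:
  fixes U :: "'u set"
  assumes "finite U" "finite \<C>" "U \<noteq> {}"
    and \<C>: "\<And>C. C \<in> \<C> \<Longrightarrow> C \<subseteq> U \<and> card C \<le> r"
    and less: "(n choose t) * card \<C> * r ^ t < card U ^ t"
  shows "\<exists>F. F ` {..<n} \<subseteq> U \<and> (\<forall>S\<subseteq>{..<n}. card S = t \<longrightarrow> \<not> (\<exists>C\<in>\<C>. F ` S \<subseteq> C))"
proof (cases "t \<le> n")
  case False
  obtain u where "u \<in> U" using assms(3) by blast
  moreover have "card S \<noteq> t" if "S \<subseteq> {..<n}" for S
    using card_mono[OF _ that] False by simp
  ultimately show ?thesis by (intro exI[of _ "\<lambda>_. u"]) auto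
next
  case True
  \<comment> \<open>\<open>bad\<close> collects the maps sending \<open>S\<close> into
    \<open>C\<close>; a uniformly random map does so with probability at most
    \<open>(r / card U) ^ t\<close>.\<close>
  define bad where "bad = (\<lambda>(S, C). PiE {..<n} (\<lambda>i. if i \<in> S then C else U))"
  define T where "T = {S. S \<subseteq> {..<n} \<and> card S = t}"
  have fT: "finite T" by (simp add: T_def)
  have card_bad: "card (bad (S, C)) \<le> r ^ t * card U ^ (n - t)" if "S \<in> T" "C \<in> \<C>" for S C
  proof -
    have S: "S \<subseteq> {..<n}" "card S = t" using that by (auto simp: T_def)
    have "card (bad (S, C)) = (\<Prod>i<n. if i \<in> S then card C else card U)"
      by (simp add: bad_def card_PiE if_distrib)
    also have "\<dots> = card C ^ card S * card U ^ card ({..<n} - S)"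
      using S(1) by (simp add: prod.If_cases Int_absorb1 Diff_eq flip: Diff_eq)
    also have "\<dots> = card C ^ t * card U ^ (n - t)"
      using S by (simp add: card_Diff_subset finite_subset)
    also have "\<dots> \<le> r ^ t * card U ^ (n - t)"
      using \<C>[OF that(2)] by (intro mult_right_mono power_mono) auto
    finally show ?thesis .
  qed
  have "card (\<Union>z\<in>T \<times> \<C>. bad z) \<le> (\<Sum>z\<in>T \<times> \<C>. card (bad z))"
    using fT assms by (intro card_UN_le) auto
  also have "\<dots> \<le> (\<Sum>z\<in>T \<times> \<C>. r ^ t * card U ^ (n - t))"
    by (rule sum_mono) (use card_bad in auto)
  also have "\<dots> = ((n choose t) * card \<C> * r ^ t) * card U ^ (n - t)"
    using n_subsets[of "{..<n}" t] by (simp add: T_def card_cartesian_product)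
  also have "\<dots> < card U ^ t * card U ^ (n - t)"
    using less assms by (intro mult_strict_right_mono) (auto simp: card_gt_0_iff)
  also have "\<dots> = card (PiE {..<n} (\<lambda>_. U))"
    using True by (simp add: card_PiE flip: power_add)
  finally have lt: "card (\<Union>z\<in>T \<times> \<C>. bad z) < card (PiE {..<n} (\<lambda>_. U))" .
  have "bad z \<subseteq> PiE {..<n} (\<lambda>_. U)" if zTC: "z \<in> T \<times> \<C>" for z
  proof -
    obtain S C where z: "z = (S, C)" "C \<in> \<C>" using zTC by blast
    show ?thesis unfolding z(1) bad_def prod.case by (rule PiE_mono) (use \<C>[OF z(2)] in auto)
  qed
  then have "(\<Union>z\<in>T \<times> \<C>. bad z) \<subseteq> PiE {..<n} (\<lambda>_. U)" by (rule UN_least)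
  then have "finite (\<Union>z\<in>T \<times> \<C>. bad z)"
    by (rule finite_subset) (simp add: assms(1) finite_PiE)
  then have "\<not> PiE {..<n} (\<lambda>_. U) \<subseteq> (\<Union>z\<in>T \<times> \<C>. bad z)"
    using lt card_mono leD by blast
  then obtain F where F: "F \<in> PiE {..<n} (\<lambda>_. U)" "F \<notin> (\<Union>z\<in>T \<times> \<C>. bad z)"
    by (metis subsetI)
  have "\<not> F ` S \<subseteq> C" if "S \<subseteq> {..<n}" "card S = t" "C \<in> \<C>" for S C
  proof
    assume "F ` S \<subseteq> C"
    have "F \<in> bad (S, C)" unfolding bad_def prod.case
    proof (rule PiE_I)
      show "F i \<in> (if i \<in> S then C else U)" if "i \<in> {..<n}" for i
        using PiE_mem[OF F(1) that] \<open>F ` S \<subseteq> C\<close> by (simp add: image_subset_iff)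
      show "F i = undefined" if "i \<notin> {..<n}" for i using PiE_arb[OF F(1) that] .
    qed
    moreover have "(S, C) \<in> T \<times> \<C>" using that by (simp add: T_def)
    ultimately show False using F(2) by (metis UN_I)
  qed
  moreover have "F ` {..<n} \<subseteq> U" using F(1) by (auto simp: PiE_iff)
  ultimately show ?thesis by (intro exI[of _ F]) simp
qed

lemma exists_colouring:
  fixes V :: "'v set"
  assumes V: "finite V" "V \<noteq> {}"
    and adj: "\<And>u v. adj u v \<longleftrightarrow> adj v u" "\<And>v. \<not> adj v v"
    and K4_free: "\<And>S. S \<subseteq> V \<Longrightarrow> card S = 4 \<Longrightarrow> \<exists>u\<in>S. \<exists>v\<in>S. u \<noteq> v \<and> \<not> adj u v"
    and \<C>: "finite \<C>" "\<And>C. C \<in> \<C> \<Longrightarrow> C \<subseteq> V \<and> card C \<le> r"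
    and cover: "\<And>I. I \<subseteq> V \<Longrightarrow> independent_in adj I \<Longrightarrow> \<exists>C\<in>\<C>. I \<subseteq> C"
    and less: "(n choose t) * card \<C> ^ K * (r ^ K) ^ t < (card V ^ K) ^ t"
  shows "\<exists>c. edge_colouring n (Suc K) c \<and> (\<forall>i<K. \<not> mono_clique n c i 4) \<and> \<not> mono_clique n c K t"
proof -
  define U where "U = PiE {..<K} (\<lambda>_. V)"
  define \<D> where "\<D> = (\<lambda>C. PiE {..<K} C) ` PiE {..<K} (\<lambda>_. \<C>)"
  have f\<D>: "finite \<D>" unfolding \<D>_def using \<C>(1) by (intro finite_imageI finite_PiE) auto
  have c\<D>: "card \<D> \<le> card \<C> ^ K"
    unfolding \<D>_def using \<C>(1) card_image_le[of "PiE {..<K} (\<lambda>_. \<C>)" "PiE {..<K}"]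
    by (simp add: finite_PiE card_PiE)
  have U: "finite U" "U \<noteq> {}" "card U = card V ^ K"
    unfolding U_def using V by (auto simp: finite_PiE card_PiE PiE_eq_empty_iff)
  have D: "D \<subseteq> U \<and> card D \<le> r ^ K" if D_in: "D \<in> \<D>" for D
  proof -
    obtain C where C: "D = PiE {..<K} C" "C \<in> PiE {..<K} (\<lambda>_. \<C>)"
      using D_in by (auto simp: \<D>_def)
    have Ci: "C i \<subseteq> V \<and> card (C i) \<le> r" if "i < K" for i
      using \<C>(2) PiE_mem[OF C(2), of i] that by simp
    have "card D = (\<Prod>i<K. card (C i))" unfolding C(1) by (simp add: card_PiE)
    also have "\<dots> \<le> (\<Prod>i<K. r)" using Ci by (intro prod_mono) auto
    finally have "card D \<le> r ^ K" by simp
    moreover have "D \<subseteq> U" unfolding C(1) U_def using Ci by (intro PiE_mono) auto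
    ultimately show ?thesis by simp
  qed
  have "(n choose t) * card \<D> * (r ^ K) ^ t \<le> (n choose t) * card \<C> ^ K * (r ^ K) ^ t"
    using c\<D> by (intro mult_right_mono mult_left_mono) auto
  then have "(n choose t) * card \<D> * (r ^ K) ^ t < card U ^ t"
    using less unfolding U(3) by (rule le_less_trans)
  with exists_map_avoiding[OF U(1) f\<D> U(2), of "r ^ K"] D
  have "\<exists>F. F ` {..<n} \<subseteq> U \<and> (\<forall>S\<subseteq>{..<n}. card S = t \<longrightarrow> \<not> (\<exists>D\<in>\<D>. F ` S \<subseteq> D))"
    by simp
  then obtain F where F: "F ` {..<n} \<subseteq> U"
      "\<forall>S\<subseteq>{..<n}. card S = t \<longrightarrow> \<not> (\<exists>D\<in>\<D>. F ` S \<subseteq> D)" by (elim exE conjE)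
  have FV: "F u i \<in> V" if "u < n" "i < K" for u i
  proof -
    have "F u \<in> U" using F(1) that by auto
    then show ?thesis using that PiE_mem[of "F u" "{..<K}" "\<lambda>_. V" i] by (simp add: U_def)
  qed
  \<comment> \<open>The default \<open>K\<close> is the last colour, used exactly when no coordinate
    is adjacent.\<close>
  define c where "c u v = (if \<exists>i<K. adj (F u i) (F v i) then LEAST i. i < K \<and> adj (F u i) (F v i) else K)" for u v
  have c_less: "c u v < K \<and> adj (F u (c u v)) (F v (c u v))" if "\<exists>i<K. adj (F u i) (F v i)" for u v
    using LeastI_ex[OF that] that by (simp add: c_def)
  have c_K: "c u v = K \<longleftrightarrow> (\<forall>i<K. \<not> adj (F u i) (F v i))" for u v
    using c_less[of u v] by (cases "\<exists>i<K. adj (F u i) (F v i)") (auto simp: c_def)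
  have "c u v = c v u" for u v
  proof -
    have e: "adj (F u i) (F v i) \<longleftrightarrow> adj (F v i) (F u i)" for i by (rule adj(1))
    show ?thesis unfolding c_def e by (rule refl)
  qed
  moreover have "c u v < Suc K" for u v
    using c_less[of u v] c_K[of u v] by (cases "c u v = K") (auto simp: less_Suc_eq)
  ultimately have "edge_colouring n (Suc K) c" unfolding edge_colouring_def by blast
  moreover have "\<not> mono_clique n c i 4" if "i < K" for i
  proof
    assume "mono_clique n c i 4"
    then obtain S where S: "S \<subseteq> {..<n}" "card S = 4" "\<And>u v. u \<in> S \<Longrightarrow> v \<in> S \<Longrightarrow> u \<noteq> v \<Longrightarrow> c u v = i"
      unfolding mono_clique_def by blast
    have a: "adj (F u i) (F v i)" if "u \<in> S" "v \<in> S" "u \<noteq> v" for u v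
    proof -
      have "c u v = i" using that by (rule S(3))
      moreover from this have "\<exists>j<K. adj (F u j) (F v j)"
        using c_K[of u v] \<open>i < K\<close> by auto
      then have "adj (F u (c u v)) (F v (c u v))" using c_less by blast
      ultimately show ?thesis by simp
    qed
    \<comment> \<open>\<open>F\<close> itself may identify vertices, but irreflexivity of
      \<open>adj\<close> keeps coordinate \<open>i\<close> injective on a clique of colour
      \<open>i\<close>, so its image is a genuine \<open>K4\<close>.\<close>
    have "inj_on (\<lambda>u. F u i) S"
    proof (rule inj_onI)
      fix u v assume "u \<in> S" "v \<in> S" "F u i = F v i"
      then show "u = v" using a[of u v] adj(2)[of "F v i"] by (cases "u = v") auto
    qed
    then have "card ((\<lambda>u. F u i) ` S) = 4" using S(2) by (simp add: card_image)
    moreover have "(\<lambda>u. F u i) ` S \<subseteq> V" using S(1) FV \<open>i < K\<close> by auto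
    ultimately obtain x y where xy: "x \<in> (\<lambda>u. F u i) ` S" "y \<in> (\<lambda>u. F u i) ` S" "x \<noteq> y" "\<not> adj x y"
      using K4_free by blast
    then obtain u v where "u \<in> S" "v \<in> S" "x = F u i" "y = F v i" by blast
    then show False using a[of u v] xy by auto
  qed
  moreover have "\<not> mono_clique n c K t"
  proof
    assume "mono_clique n c K t"
    then obtain S where S: "S \<subseteq> {..<n}" "card S = t" "\<And>u v. u \<in> S \<Longrightarrow> v \<in> S \<Longrightarrow> u \<noteq> v \<Longrightarrow> c u v = K"
      unfolding mono_clique_def by blast
    \<comment> \<open>For the last colour injectivity may fail harmlessly: each projection is still
      independent, hence covered by a container, and the product of these contains the
      image.\<close>
    have "\<exists>C\<in>\<C>. (\<lambda>u. F u i) ` S \<subseteq> C" if "i < K" for i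
    proof (rule cover)
      show "(\<lambda>u. F u i) ` S \<subseteq> V" using S(1) FV that by auto
      have "\<not> adj (F u i) (F v i)" if "u \<in> S" "v \<in> S" for u v
      proof (cases "u = v")
        case True
        then show ?thesis using adj(2) by simp
      next
        case False
        then have "c u v = K" using that by (intro S(3))
        then show ?thesis using c_K \<open>i < K\<close> by blast
      qed
      then show "independent_in adj ((\<lambda>u. F u i) ` S)" by (auto simp: independent_in_def)
    qed
    then obtain C where C: "\<And>i. i < K \<Longrightarrow> C i \<in> \<C> \<and> (\<lambda>u. F u i) ` S \<subseteq> C i" by metis
    define C' where "C' = restrict C {..<K}"
    have "PiE {..<K} C' \<in> \<D>"
      unfolding \<D>_def by (rule imageI) (use C in \<open>auto simp: C'_def\<close>)
    moreover have "F ` S \<subseteq> PiE {..<K} C'"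
    proof
      fix x assume "x \<in> F ` S"
      then obtain u where u: "u \<in> S" "x = F u" by blast
      then have "F u \<in> U" using F(1) S(1) by auto
      show "x \<in> PiE {..<K} C'"
      proof (rule PiE_I)
        show "x i \<in> C' i" if "i \<in> {..<K}" for i using C[of i] u that by (auto simp: C'_def)
        show "x i = undefined" if "i \<notin> {..<K}" for i
          using PiE_arb[of x "{..<K}" "\<lambda>_. V" i] that \<open>F u \<in> U\<close> u by (simp add: U_def)
      qed
    qed
    ultimately show False using F(2) S(1,2) by blast
  qed
  ultimately show ?thesis by blast
qed

subsection \<open>Ramsey numbers\<close>

text \<open>Ramsey's theorem, needed so that the \<open>LEAST\<close> in \<open>ramsey_k4t\<close>
  is attained.\<close>

lemma exists_ramsey_number:
  "\<exists>n. \<forall>c. edge_colouring n k c \<longrightarrow> (\<exists>i<k - 1. mono_clique n c i 4) \<or> mono_clique n c (k - 1) t"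
  if k: "k \<ge> 1"
proof -
  define qs where "qs = replicate (k - 1) 4 @ [t]"
  have len: "length qs = k" using k by (simp add: qs_def)
  obtain n where n: "partn_lst {..<n::nat} qs 2" using ramsey_full by blast
  have "(\<exists>i<k - 1. mono_clique n c i 4) \<or> mono_clique n c (k - 1) t" if c: "edge_colouring n k c" for c
  proof -
    \<comment> \<open>The library theorem colours two-element sets; minimum and maximum recover an
      ordered pair, and symmetry makes the order immaterial.\<close>
    define f where "f e = c (Min e) (Max e)" for e
    have f: "f {u, v} = c u v" if "u < n" "v < n" "u \<noteq> v" for u v
    proof (cases "u < v")
      case True
      then show ?thesis by (simp add: f_def)
    next
      case False
      then have "f {u, v} = c v u" using that by (simp add: f_def min_def max_def)
      then show ?thesis using c that by (auto simp: edge_colouring_def)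
    qed
    have "f \<in> nsets {..<n} 2 \<rightarrow> {..<length qs}"
    proof
      fix e assume "e \<in> nsets {..<n} 2"
      then obtain u v where "e = {u, v}" "u < n" "v < n" "u \<noteq> v" by (auto elim: nsets2_E)
      then show "f e \<in> {..<length qs}" using f c len by (auto simp: edge_colouring_def)
    qed
    then obtain i H where i: "i < length qs" and H: "H \<in> nsets {..<n} (qs ! i)" and fH: "f ` nsets H 2 \<subseteq> {i}"
      using partn_lstE[OF n _ refl] by metis
    have H': "H \<subseteq> {..<n}" "card H = qs ! i" using H by (auto simp: nsets_def)
    have "c u v = i" if "u \<in> H" "v \<in> H" "u \<noteq> v" for u v
    proof -
      have "f {u, v} \<in> f ` nsets H 2" using that by (intro imageI) simp
      then have "f {u, v} = i" using fH by blast
      moreover have "u < n" "v < n" using H'(1) that by auto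
      ultimately show ?thesis using f[OF _ _ that(3)] by simp
    qed
    then have "mono_clique n c i (qs ! i)" using H' unfolding mono_clique_def by blast
    moreover have "qs ! i = (if i < k - 1 then 4 else t)"
      using i by (auto simp: qs_def nth_append)
    moreover have "i < k - 1 \<or> i = k - 1" using i len by linarith
    ultimately show ?thesis by auto
  qed
  then show ?thesis by blast
qed

text \<open>Good colourings are demanded for every \<open>n \<le> N\<close>, so the least Ramsey
  size is excluded directly, without arguing that the property is monotone in
  \<open>n\<close>.\<close>

lemma ramsey_k4t_greater:
  assumes "k \<ge> 1"
    and "\<And>n. n \<le> N \<Longrightarrow> \<exists>c. edge_colouring n k c \<and> (\<forall>i<k - 1. \<not> mono_clique n c i 4) \<and> \<not> mono_clique n c (k - 1) t"
  shows "N < ramsey_k4t k t"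
proof (rule ccontr)
  assume "\<not> N < ramsey_k4t k t"
  then obtain c where c: "edge_colouring (ramsey_k4t k t) k c"
      "\<forall>i<k - 1. \<not> mono_clique (ramsey_k4t k t) c i 4" "\<not> mono_clique (ramsey_k4t k t) c (k - 1) t"
    using assms(2)[of "ramsey_k4t k t"] by auto
  have "\<forall>c. edge_colouring (ramsey_k4t k t) k c \<longrightarrow>
      (\<exists>i<k - 1. mono_clique (ramsey_k4t k t) c i 4) \<or> mono_clique (ramsey_k4t k t) c (k - 1) t"
    unfolding ramsey_k4t_def using exists_ramsey_number[OF assms(1), of t] by (rule LeastI_ex)
  with c show False by blast
qed

section \<open>Numerical estimates and choice of parameters\<close>

lemma self_power_le_fact: "real t ^ t \<le> exp (real t) * fact t"
proof -
  \<comment> \<open>The left side is a single term of the exponential series at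
    \<open>t\<close>.\<close>
  have "real t ^ t / fact t \<le> (\<Sum>n. real t ^ n /\<^sub>R fact n)"
    using sum_le_suminf[OF summable_exp_generic[of "real t"], of "{t}"]
    by (simp add: field_simps)
  also have "\<dots> = exp (real t)" by (simp add: exp_def)
  finally show ?thesis by (simp add: field_simps)
qed

text \<open>The familiar bound \<open>(e * n / t) ^ t\<close> on the binomial coefficient, with
  \<open>e \<le> 3\<close>.\<close>

lemma binomial_power_bound:
  assumes "t > 0" "3 * real n < real t * x"
  shows "real (n choose t) < x ^ t"
proof -
  have "real (n choose t) * fact t \<le> real n ^ t"
    using binomial_fact_pow[of n t] by (metis of_nat_fact of_nat_le_iff of_nat_mult of_nat_power)
  then have "real (n choose t) * (real t ^ t) \<le> real n ^ t * exp (real t)"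
    using self_power_le_fact[of t]
    by (smt (verit, ccfv_SIG) exp_gt_zero fact_gt_zero mult.assoc mult.commute mult_le_cancel_left_pos of_nat_0_le_iff mult_left_mono)
  also have "exp (real t) = exp 1 ^ t" by (simp flip: exp_of_nat_mult)
  also have "real n ^ t * exp 1 ^ t \<le> (3 * real n) ^ t"
    using exp_le by (simp add: power_mult_distrib mult.commute power_mono mult_left_mono)
  also have "\<dots> < (real t * x) ^ t" using assms by (intro power_strict_mono) auto
  finally have "real t ^ t * real (n choose t) < real t ^ t * x ^ t"
    by (simp add: power_mult_distrib mult.commute)
  then show ?thesis using assms(1) by simp
qed

text \<open>The first inequality keeps the selected vertices within \<open>q ^ 2\<close>; it fails
  at \<open>s = 15\<close>, hence the threshold 16. The second feeds the union bound over
  colourings.\<close>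

lemma power_dominates_square:
  assumes "16 \<le> s"
  shows "192 * s\<^sup>2 \<le> 2 ^ s \<and> 4 * s + 1 \<le> (2::nat) ^ (s - 2)"
  using assms
proof (induction s rule: dec_induct)
  case (step s)
  have "2 * s + 1 \<le> s * s" using step.hyps mult_le_mono1[of 16 s s] by linarith
  then have "192 * (Suc s)\<^sup>2 \<le> 2 * (192 * s\<^sup>2)" by (simp add: power2_eq_square)
  moreover have "Suc s - 2 = Suc (s - 2)" using step.hyps by simp
  ultimately show ?case using step by simp
qed simp

lemma exists_container_graph:
  assumes s: "16 \<le> s"
  defines "q \<equiv> (2::nat) ^ s"
  shows "\<exists>(V :: (bit alg_closure \<times> bit alg_closure) set set) adj \<C>.
      finite V \<and> q ^ 4 \<le> 2 * card V \<and> (\<forall>u v. adj u v \<longleftrightarrow> adj v u) \<and> (\<forall>v. \<not> adj v v) \<and>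
      (\<forall>S\<subseteq>V. card S = 4 \<longrightarrow> (\<exists>u\<in>S. \<exists>v\<in>S. u \<noteq> v \<and> \<not> adj u v)) \<and>
      finite \<C> \<and> card \<C> \<le> 2 ^ (960 * s ^ 3 * q) \<and> (\<forall>C\<in>\<C>. C \<subseteq> V \<and> card C \<le> 9 * q\<^sup>2) \<and>
      (\<forall>I\<subseteq>V. independent_in adj I \<longrightarrow> (\<exists>C\<in>\<C>. I \<subseteq> C))"
proof -
  obtain P :: "(bit alg_closure \<times> bit alg_closure) set" and \<L> where "dense_unital q P \<L>"
    using exists_dense_unital[of s] s unfolding q_def by auto
  then interpret dense_unital q P \<L> .
  obtain \<kappa> where \<kappa>: "\<And>W. W \<subseteq> \<L> \<Longrightarrow> 8 * q\<^sup>2 \<le> card W \<Longrightarrow>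
      \<exists>L\<in>W. card W \<le> 96 * s * q * card {L'\<in>W. adj \<kappa> L L'}"
    using exists_supersaturated[OF q_def[THEN meta_eq_to_obj_eq]] s power_dominates_square[OF s] by auto
  define \<beta> :: real where "\<beta> = 1 / (96 * s * q)"
  \<comment> \<open>Chosen so that \<open>\<beta> * l = 2 * s\<close>: then
    \<open>(1 - \<beta>) ^ l\<close> is at most \<open>1 / q ^ 2\<close>, which shrinks the at most
    \<open>q ^ 4\<close> lines below \<open>8 * q ^ 2\<close>.\<close>
  define l where "l = 192 * s\<^sup>2 * q"
  have spos: "s > 0" "q > 0" using s by (auto simp: q_def)
  have \<beta>: "0 \<le> \<beta>" "\<beta> \<le> 1"
  proof -
    have "1 \<le> 96 * s * q" using spos by (simp add: Suc_le_eq)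
    then have "1 \<le> real (96 * s * q)" by linarith
    then show "\<beta> \<le> 1" using spos by (simp add: \<beta>_def)
  qed (simp add: \<beta>_def)
  have deg: "\<exists>L\<in>W. \<beta> * card W \<le> card {L'\<in>W. adj \<kappa> L L'}" if W: "W \<subseteq> \<L>" "8 * q\<^sup>2 \<le> card W" for W
  proof -
    obtain L where L: "L \<in> W" "card W \<le> 96 * s * q * card {L'\<in>W. adj \<kappa> L L'}"
      using \<kappa>[OF W] by blast
    have "real (card W) \<le> real (96 * s * q) * card {L'\<in>W. adj \<kappa> L L'}"
      using L(2) by (metis of_nat_le_iff of_nat_mult)
    then have "\<beta> * card W \<le> card {L'\<in>W. adj \<kappa> L L'}"
      using spos by (simp add: \<beta>_def field_simps)
    with L(1) show ?thesis by blast
  qed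
  have "card \<L> * (1 - \<beta>) ^ l < 8 * q\<^sup>2"
  proof -
    have "(1 - \<beta>) ^ l \<le> exp (- \<beta>) ^ l"
      using \<beta> exp_ge_add_one_self[of "- \<beta>"] by (intro power_mono) auto
    also have "\<dots> = exp (- (2 * s))"
      using spos by (simp add: \<beta>_def l_def power2_eq_square flip: exp_of_nat_mult)
    also have "\<dots> = 1 / exp 1 ^ (2 * s)" by (simp add: exp_minus field_simps flip: exp_of_nat_mult)
    also have "\<dots> \<le> 1 / 2 ^ (2 * s)"
      using exp_ge_add_one_self[of 1] by (intro divide_left_mono power_mono) auto
    also have "\<dots> = 1 / real q ^ 2" by (simp add: q_def mult.commute flip: power_mult)
    finally have "card \<L> * (1 - \<beta>) ^ l \<le> real q ^ 4 * (1 / real q ^ 2)"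
      using card_blocks(2) \<beta> by (intro mult_mono) (auto simp flip: of_nat_power)
    also have "\<dots> = real q ^ 2" using spos by (simp add: field_simps flip: power_add)
    also have "\<dots> < 8 * q\<^sup>2" using spos by simp
    finally show ?thesis by simp
  qed
  then have "\<exists>\<C>. finite \<C> \<and> card \<C> \<le> (card \<L> + 1) ^ l
      \<and> (\<forall>C\<in>\<C>. C \<subseteq> \<L> \<and> card C \<le> 8 * q\<^sup>2 + l)
      \<and> (\<forall>I\<subseteq>\<L>. independent_in (adj \<kappa>) I \<longrightarrow> (\<exists>C\<in>\<C>. I \<subseteq> C))"
    by (intro kleitman_winston_containers[OF finite_blocks \<beta> deg subset_refl])
  then obtain \<C> where \<C>: "finite \<C>" "card \<C> \<le> (card \<L> + 1) ^ l"
      "\<forall>C\<in>\<C>. C \<subseteq> \<L> \<and> card C \<le> 8 * q\<^sup>2 + l"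
      "\<forall>I\<subseteq>\<L>. independent_in (adj \<kappa>) I \<longrightarrow> (\<exists>C\<in>\<C>. I \<subseteq> C)"
    by (elim exE conjE)
  have "card \<C> \<le> 2 ^ (960 * s ^ 3 * q)"
  proof -
    \<comment> \<open>Bounding by \<open>q ^ 5 = 2 ^ (5 * s)\<close> gives the exponent
      \<open>5 * s * l = 960 * s ^ 3 * q\<close>.\<close>
    have "card \<L> + 1 \<le> 2 * q ^ 4" using card_blocks(2) spos one_le_power[of q 4] by linarith
    also have "\<dots> \<le> q * q ^ 4" using q_ge_2 by (rule mult_right_mono) simp
    also have "\<dots> = 2 ^ (5 * s)" by (simp add: q_def mult.commute flip: power_mult power_add)
    finally have "(card \<L> + 1) ^ l \<le> (2 ^ (5 * s)) ^ l" by (rule power_mono) simp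
    also have "\<dots> = 2 ^ (960 * s ^ 3 * q)"
      by (simp add: l_def power2_eq_square power3_eq_cube mult_ac flip: power_mult)
    finally show ?thesis using \<C>(2) by simp
  qed
  moreover have "l \<le> q\<^sup>2"
    unfolding l_def power2_eq_square[of q]
    by (rule mult_right_mono) (use power_dominates_square[OF s] in \<open>auto simp: q_def\<close>)
  then have "\<forall>C\<in>\<C>. C \<subseteq> \<L> \<and> card C \<le> 9 * q\<^sup>2" using \<C>(3) by fastforce
  ultimately show ?thesis
    using finite_blocks card_blocks(1) adj_sym[of \<kappa>] adj_irrefl[of \<kappa>] adj_K4_free[of _ \<kappa>] \<C>(1,4)
    by (intro exI[of _ \<L>] exI[of _ "adj \<kappa>"] exI[of _ \<C>] conjI allI impI) auto
qed

text \<open>In each coordinate a container holds at most a fraction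
  \<open>9 * q ^ 2 / (q ^ 4 / 2) = 18 / q ^ 2\<close> of the vertices. The at most
  \<open>2 ^ t\<close> containers cost another factor 2 per clique vertex, whence 36; the factor 3
  comes from \<open>binomial_power_bound\<close>.\<close>

lemma exists_ramsey_colouring:
  assumes s: "16 \<le> s" and t: "960 * s ^ 3 * 2 ^ s \<le> t"
    and n: "3 * 36 ^ K * n < t * (2 ^ s) ^ (2 * K)"
  shows "\<exists>c. edge_colouring n (Suc K) c \<and> (\<forall>i<K. \<not> mono_clique n c i 4) \<and> \<not> mono_clique n c K t"
proof -
  define q where "q = (2::nat) ^ s"
  have q0: "q > 0" by (simp add: q_def)
  obtain V :: "(bit alg_closure \<times> bit alg_closure) set set" and adj \<C> where
    V: "finite V" "q ^ 4 \<le> 2 * card V" and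
    adj: "\<forall>u v. adj u v \<longleftrightarrow> adj v u" "\<forall>v. \<not> adj v v"
      "\<forall>S\<subseteq>V. card S = 4 \<longrightarrow> (\<exists>u\<in>S. \<exists>v\<in>S. u \<noteq> v \<and> \<not> adj u v)" and
    \<C>: "finite \<C>" "card \<C> \<le> 2 ^ (960 * s ^ 3 * q)" "\<forall>C\<in>\<C>. C \<subseteq> V \<and> card C \<le> 9 * q\<^sup>2"
      "\<forall>I\<subseteq>V. independent_in adj I \<longrightarrow> (\<exists>C\<in>\<C>. I \<subseteq> C)"
    using exists_container_graph[OF s, folded q_def] by (elim exE conjE) (rule that)
  have t0: "t > 0" using t s by (cases "t = 0") auto
  define x where "x = (real q ^ 2 / 36) ^ K"
  have "real (3 * 36 ^ K * n) < real (t * q ^ (2 * K))"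
    using n unfolding q_def by (simp only: of_nat_less_iff)
  then have "3 * real n < t * x"
    by (simp add: x_def power_divide field_simps flip: power_mult)
  then have nt: "real (n choose t) < x ^ t" by (rule binomial_power_bound[OF t0])
  have "card \<C> \<le> 2 ^ t"
  proof -
    have "960 * s ^ 3 * q \<le> t" using t by (simp add: q_def)
    then have "(2::nat) ^ (960 * s ^ 3 * q) \<le> 2 ^ t" by (rule power_increasing) simp
    with \<C>(2) show ?thesis by (rule le_trans)
  qed
  then have "card \<C> ^ K \<le> (2 ^ t) ^ K" by (rule power_mono) simp
  then have "(n choose t) * card \<C> ^ K * ((9 * q\<^sup>2) ^ K) ^ t \<le> (n choose t) * (2 ^ t) ^ K * ((9 * q\<^sup>2) ^ K) ^ t"
    by (intro mult_right_mono mult_left_mono) auto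
  also have "\<dots> < (card V ^ K) ^ t"
  proof -
    have "real ((n choose t) * (2 ^ t) ^ K * ((9 * q\<^sup>2) ^ K) ^ t)
        = real (n choose t) * ((2 ^ t) ^ K * ((9 * real q ^ 2) ^ K) ^ t)" by simp
    also have "\<dots> < x ^ t * ((2 ^ t) ^ K * ((9 * real q ^ 2) ^ K) ^ t)"
      using nt q0 by (intro mult_strict_right_mono) auto
    also have "\<dots> = ((real q ^ 2 / 36 * 2 * (9 * real q ^ 2)) ^ K) ^ t"
    proof -
      have "((2::real) ^ t) ^ K = (2 ^ K) ^ t" by (simp add: mult.commute flip: power_mult)
      then show ?thesis unfolding x_def by (simp only: power_mult_distrib)
    qed
    also have "real q ^ 2 / 36 * 2 * (9 * real q ^ 2) = real q ^ 4 / 2"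
      by (simp add: flip: power_add)
    also have "((real q ^ 4 / 2) ^ K) ^ t \<le> (real (card V) ^ K) ^ t"
    proof -
      have "real (q ^ 4) \<le> real (2 * card V)" using V(2) by (simp only: of_nat_le_iff)
      then show ?thesis by (intro power_mono) auto
    qed
    finally have "real ((n choose t) * (2 ^ t) ^ K * ((9 * q\<^sup>2) ^ K) ^ t) < real ((card V ^ K) ^ t)"
      by simp
    then show ?thesis by (simp only: of_nat_less_iff)
  qed
  finally have less: "(n choose t) * card \<C> ^ K * ((9 * q\<^sup>2) ^ K) ^ t < (card V ^ K) ^ t" .
  have "V \<noteq> {}" using V(2) q0 by auto
  show ?thesis
    by (rule exists_colouring[OF V(1) \<open>V \<noteq> {}\<close> _ _ _ \<C>(1) _ _ less, of adj])
       (use adj \<C>(3,4) in \<open>simp_all\<close>)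
qed

lemma ramsey_k4t_lower_bound:
  assumes "16 \<le> s" "960 * s ^ 3 * 2 ^ s \<le> t"
  shows "t * (2 ^ s) ^ (2 * K) \<le> 3 * 36 ^ K * ramsey_k4t (Suc K) t"
proof (rule ccontr)
  assume "\<not> ?thesis"
  then have less: "3 * 36 ^ K * ramsey_k4t (Suc K) t < t * (2 ^ s) ^ (2 * K)" by simp
  \<comment> \<open>If the bound failed, good colourings would exist up to the Ramsey number
    itself.\<close>
  have "3 * 36 ^ K * n < t * (2 ^ s) ^ (2 * K)" if "n \<le> ramsey_k4t (Suc K) t" for n
    by (rule le_less_trans[OF mult_left_mono[OF that] less]) simp
  then have "ramsey_k4t (Suc K) t < ramsey_k4t (Suc K) t"
    using exists_ramsey_colouring[OF assms] by (intro ramsey_k4t_greater) auto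
  then show False by simp
qed

text \<open>The greatest admissible \<open>s\<close> is taken. Its successor fails, and
  \<open>Suc s \<le> 2 * s\<close> turns 960 into \<open>960 * 8 * 2 = 15360\<close>.\<close>

lemma exists_scale:
  assumes "960 * 16 ^ 3 * 2 ^ 16 \<le> t"
  shows "\<exists>s. 16 \<le> s \<and> 960 * s ^ 3 * 2 ^ s \<le> t \<and> t \<le> 15360 * s ^ 3 * (2::nat) ^ s"
proof -
  define Q where "Q s \<longleftrightarrow> 960 * s ^ 3 * 2 ^ s \<le> t" for s
  have "Q 16" using assms by (simp add: Q_def)
  have bd: "s \<le> t" if "Q s" for s
  proof (cases "s = 0")
    case False
    have "s \<le> 2 ^ s" using less_exp[of s] by simp
    also have "\<dots> \<le> 960 * s ^ 3 * 2 ^ s" using False by simp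
    finally show ?thesis using that by (simp add: Q_def)
  qed simp
  define s where "s = Greatest Q"
  have "Q s" unfolding s_def using \<open>Q 16\<close> bd by (rule GreatestI_nat)
  have "16 \<le> s" unfolding s_def using \<open>Q 16\<close> bd by (rule Greatest_le_nat)
  have "\<not> Q (Suc s)"
    using Greatest_le_nat[of Q "Suc s" t] bd unfolding s_def by fastforce
  then have "t \<le> 960 * Suc s ^ 3 * 2 ^ Suc s" by (simp add: Q_def)
  also have "\<dots> \<le> 960 * (2 * s) ^ 3 * 2 ^ Suc s"
    using \<open>16 \<le> s\<close> by (intro mult_right_mono mult_left_mono power_mono) auto
  also have "\<dots> = 15360 * s ^ 3 * 2 ^ s" by (simp add: power_mult_distrib)
  finally show ?thesis using \<open>16 \<le> s\<close> \<open>Q s\<close> by (auto simp: Q_def)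
qed

theorem theorem2:
  fixes k :: nat
  assumes "k \<ge> 3"
  shows "\<exists>\<gamma>::real. \<gamma> > 0 \<and>
    (\<forall>\<^sub>F t in sequentially.
       real (ramsey_k4t k t) \<ge> \<gamma> * real t ^ (2 * k - 1) / (ln (real t)) ^ (6 * (k - 1)))"
proof -
  obtain K where k: "k = Suc K" using assms by (cases k) auto
  \<comment> \<open>Here \<open>122880 = 15360 * 2 ^ 3\<close>, the cube coming from
    \<open>s \<le> 2 * ln t\<close>; the other factors are those of
    \<open>ramsey_k4t_lower_bound\<close>.\<close>
  define D :: real where "D = 3 * 36 ^ K * 122880 ^ (2 * K)"
  have "real (ramsey_k4t k t) \<ge> 1 / D * real t ^ (2 * k - 1) / (ln (real t)) ^ (6 * (k - 1))"
    if t: "960 * 16 ^ 3 * 2 ^ 16 \<le> t" for t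
  proof -
    obtain s where s: "16 \<le> s" "960 * s ^ 3 * 2 ^ s \<le> t" "t \<le> 15360 * s ^ 3 * (2::nat) ^ s"
      using exists_scale[OF t] by blast
    have t1: "real t > 1" using t by simp
    define q where "q = (2::real) ^ s"
    have "2 ^ s \<le> 960 * s ^ 3 * 2 ^ s" using s(1) by simp
    then have "2 ^ s \<le> t" using s(2) by linarith
    then have "q \<le> real t" unfolding q_def by (metis of_nat_le_iff of_nat_numeral of_nat_power)
    then have "ln q \<le> ln (real t)" using t1 by (simp add: q_def)
    moreover have "ln q = s * ln 2" by (simp add: q_def ln_realpow)
    moreover have "ln 2 \<ge> (1 / 2 :: real)" using ln2_ge_two_thirds by simp
    then have "s * (1 / 2) \<le> s * ln (2::real)" by (intro mult_left_mono) auto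
    ultimately have sL: "real s \<le> 2 * ln (real t)" by simp
    have L0: "ln (real t) > 0" using t1 by simp
    have "real t \<le> 15360 * real s ^ 3 * q"
      using s(3) unfolding q_def
      by (metis (mono_tags, lifting) of_nat_le_iff of_nat_mult of_nat_numeral of_nat_power)
    also have "\<dots> \<le> 15360 * (2 * ln (real t)) ^ 3 * q"
      using sL by (intro mult_right_mono mult_left_mono power_mono) (auto simp: q_def)
    also have "\<dots> = 122880 * ln (real t) ^ 3 * q" by (simp add: power_mult_distrib)
    finally have "real t ^ (2 * K) \<le> (122880 * ln (real t) ^ 3 * q) ^ (2 * K)"
      by (rule power_mono) simp
    \<comment> \<open>The extra factor \<open>t\<close> makes the exponent
      \<open>2 * K + 1 = 2 * k - 1\<close>, while the cubed logarithm is raised to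
      \<open>2 * K\<close>, giving \<open>6 * (k - 1)\<close>.\<close>
    then have "real t * real t ^ (2 * K) \<le> real t * (122880 * ln (real t) ^ 3 * q) ^ (2 * K)"
      by (rule mult_left_mono) simp
    also have "\<dots> = 122880 ^ (2 * K) * ln (real t) ^ (6 * K) * (real t * q ^ (2 * K))"
      by (simp add: power_mult_distrib flip: power_mult)
    also have "\<dots> \<le> 122880 ^ (2 * K) * ln (real t) ^ (6 * K) * (3 * 36 ^ K * real (ramsey_k4t k t))"
    proof (rule mult_left_mono)
      have "real (t * (2 ^ s) ^ (2 * K)) \<le> real (3 * 36 ^ K * ramsey_k4t k t)"
        using ramsey_k4t_lower_bound[OF s(1,2), of K] unfolding k by (simp only: of_nat_le_iff)
      then show "real t * q ^ (2 * K) \<le> 3 * 36 ^ K * real (ramsey_k4t k t)"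
        by (simp add: q_def)
    qed (use L0 in simp)
    finally have "real t ^ (2 * K + 1) \<le> D * ln (real t) ^ (6 * K) * real (ramsey_k4t k t)"
      by (simp add: D_def mult_ac)
    then show ?thesis
      using L0 by (simp add: k D_def field_simps)
  qed
  then have "\<forall>\<^sub>F t in sequentially.
      real (ramsey_k4t k t) \<ge> 1 / D * real t ^ (2 * k - 1) / (ln (real t)) ^ (6 * (k - 1))"
    unfolding eventually_sequentially by blast
  moreover have "1 / D > 0" by (simp add: D_def)
  ultimately show ?thesis by blast
qed

end
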